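(* Let $d=3$ and let $\{S_k,k\ge 0\}$ be the nearest-neighbor symmetric (simple) random walk on $\mathbb{Z}^3$ started at $0$ under $P_0$, with local times $l_n(x)$. There are positive constants $\underline c,\bar c$ such that for every $y$ large enough, and then for all $n$ large enough (depending on $y$), $$\exp\left(-\underline c\, y^{2/3}n^{1/3}\right)\le P_0\left(\sum_{x\in\mathbb{Z}^3} l_n^2(x)>ny\right)\le \exp\left(-\bar c\, y^{1/3}n^{1/3}\right).$$ Moreover, there is $\underline{\chi}>0$ such that, setting $\bar{\mathcal D}:=\{x\in\mathbb{Z}^3:\ l_n(x)>(\log n)^{\underline{\chi}}\}$, there is $\epsilon>0$ such that for every $y$ large enough and then all $n$ large enough (depending on $y$), $$P_0\left(\sum_{x\in\bar{\mathcal D}} l_n^2(x)>ny\right)\le \exp\left(-\bar c\, n^{1/3}(\log n)^{\epsilon}\right).$$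
   Context: For $x\in\mathbb{Z}^d$ and $n\in\mathbb{N}$, the local time $l_n(x)=\sum_{k=0}^n 1\{S_k=x\}$ is the number of visits of the walk to $x$ up to time $n$. *)

theory Defs
  imports "HOL-Probability.Probability"
begin

text \<open>The lattice \<open>\<int>\<^sup>d\<close> is the type \<^typ>\<open>int ^ 'd\<close>; its unit vectors are the \<^term>\<open>axis i (1 :: int)\<close>.\<close>

definition srw_step :: "(int ^ 'd::finite) pmf" where
  "srw_step = pmf_of_set (range (\<lambda>i. axis i 1) \<union> range (\<lambda>i. axis i (-1)))"

text \<open>The law \<open>P\<^sub>x\<close> of the walk started at \<open>x\<close>, as a measure on paths
  \<open>S :: nat \<Rightarrow> int ^ 'd\<close> with the product of the discrete sigma-algebras:
  the image of i.i.d. steps \<open>\<xi> 0, \<xi> 1, \<dots>\<close> under partial summation.\<close>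

definition srw :: "int ^ 'd::finite \<Rightarrow> (nat \<Rightarrow> int ^ 'd) measure" where
  "srw x = distr (\<Pi>\<^sub>M k\<in>UNIV. measure_pmf srw_step) (\<Pi>\<^sub>M k\<in>UNIV. count_space UNIV)
             (\<lambda>\<xi> n. x + (\<Sum>k<n. \<xi> k))"

definition local_time :: "(nat \<Rightarrow> 'a) \<Rightarrow> nat \<Rightarrow> 'a \<Rightarrow> nat" where
  "local_time S n x = (\<Sum>k\<le>n. of_bool (S k = x))"

text \<open>The map defining \<^const>\<open>srw\<close> is measurable, so \<^const>\<open>distr\<close> is not degenerate.\<close>

lemma measurable_srw_path:
  fixes x :: "int ^ 'd::finite"
  shows "(\<lambda>\<xi> (n::nat). x + (\<Sum>k<n. \<xi> k)) \<in>
    measurable (\<Pi>\<^sub>M k\<in>UNIV. measure_pmf srw_step) (\<Pi>\<^sub>M k\<in>UNIV. count_space UNIV)"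
proof (rule measurable_PiM_single')
  fix n :: nat
  let ?M = "\<Pi>\<^sub>M k\<in>(UNIV::nat set). measure_pmf (srw_step :: (int ^ 'd) pmf)"
  have cnt: "countable (UNIV :: (int ^ 'd) set)"
  proof -
    have "inj (vec_nth :: int ^ 'd \<Rightarrow> 'd \<Rightarrow> int)"
      by (simp add: inj_def vec_nth_inject)
    moreover have "countable (UNIV :: ('d \<Rightarrow> int) set)"
      using countable_PiE[of "UNIV :: 'd set" "\<lambda>_. UNIV :: int set"] by simp
    ultimately show ?thesis
      by (meson countable_image_inj_on countable_subset subset_UNIV)
  qed
  show "(\<lambda>\<xi>. x + (\<Sum>k<n. \<xi> k)) \<in> measurable ?M (count_space UNIV)"
  proof (induction n)
    case 0
    then show ?case by simp
  next
    case (Suc n)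
    have c: "(\<lambda>\<xi>. \<xi> n) \<in> measurable ?M (count_space UNIV)"
      using measurable_component_singleton[of n UNIV "\<lambda>_. measure_pmf (srw_step :: (int ^ 'd) pmf)"]
      by (simp cong: measurable_cong_sets)
    have v: "(\<lambda>\<xi>. v + \<xi> n) \<in> measurable ?M (count_space UNIV)" for v
      by (rule measurable_compose[OF c]) simp
    have "(\<lambda>\<xi>. (x + (\<Sum>k<n. \<xi> k)) + \<xi> n) \<in> measurable ?M (count_space UNIV)"
      by (rule measurable_compose_countable'[where f = "\<lambda>v \<xi>. v + \<xi> n", OF v Suc cnt])
    then show ?case by (simp add: add.assoc)
  qed
qed (auto simp: space_PiM PiE_def)

lemma prob_space_srw: "prob_space (srw x)"
  unfolding srw_def
  by (intro prob_space.prob_space_distr prob_space_PiM measurable_srw_path)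
    (rule prob_space_measure_pmf)

end

theory Submission
  imports Defs "HOL-Probability.Hoeffding" "HOL-Real_Asymp.Real_Asymp"
begin

text \<open>
  Lower bound: the product of cosines with half-period \<open>2 (r + 1)\<close> is an eigenfunction of the walk
  killed outside the cube of radius \<open>r\<close>, so the walk stays in that cube up to time \<open>n\<close> with
  probability at least \<open>cos (\<pi> / (2 (r + 1)))\<^sup>n\<close>; with \<open>r\<close> of order \<open>(n/y)^(1/3)\<close> the
  Cauchy-Schwarz inequality then forces \<open>\<Sum> l\<^sub>n\<^sup>2 > n y\<close>.

  Upper bounds: let \<open>g\<close> be a bounded positive superharmonic function with
  \<open>P g \<le> g - 1\<^sub>0\<close> and gradient of order \<open>|x|^(-2)\<close>, a substitute for the Green function, and let
  \<open>h\<^sub>k = (l\<^sub>k - L)\<^sup>+\<close>. Following the potential \<open>U\<^sub>k = \<Sum>z. h\<^sub>k(z) g(\<cdot> - z)\<close> along the walk, in the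
  manner of Tanaka's formula, gives \<open>\<Sum> h\<^sub>n\<^sup>2 \<le> C \<Sum> h\<^sub>n + 2 M\<^sub>n\<close>, where the martingale \<open>M\<close> has
  increments of size at most \<open>|\<nabla>U\<^sub>k(S\<^sub>k)|\<close>. Hence \<open>P(M\<^sub>n \<ge> a, V\<^sub>n \<le> v) \<le> exp (-a\<^sup>2 / (2 v))\<close> with
  \<open>V\<^sub>n = \<Sum> |\<nabla>U\<^sub>k(S\<^sub>k)|\<^sup>2\<close>, and cutting the kernel \<open>|x|^(-2)\<close> at radius \<open>\<rho>\<close> bounds \<open>V\<^sub>n\<close> by
  \<open>C \<parallel>l\<^sub>n\<parallel>\<^sub>2 \<parallel>h\<^sub>n\<parallel>\<^sub>2 (\<rho>^(1/2) \<parallel>h\<^sub>n\<parallel>\<^sub>2 + \<parallel>h\<^sub>n\<parallel>\<^sub>1 / \<rho>)\<close>. With \<open>L = 0\<close> and \<open>\<rho> = (n/y)^(1/3)\<close>,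
  at the first time the energy exceeds \<open>n y\<close>, this yields the rate \<open>y^(2/3) n^(1/3)\<close>. For the highly visited
  sites one takes \<open>L\<close> a power of \<open>log n\<close>: then \<open>\<parallel>h\<^sub>n\<parallel>\<^sub>1 \<le> \<parallel>l\<^sub>n\<parallel>\<^sub>2\<^sup>2 / L\<close> gains a factor \<open>L^(1/3)\<close>.
\<close>

section \<open>One step of the walk\<close>

abbreviation paths :: "(nat \<Rightarrow> int ^ 'd::finite) measure" where
  "paths \<equiv> \<Pi>\<^sub>M k\<in>UNIV. count_space UNIV"

text \<open>Measurability with respect to the positions up to time \<open>n\<close>, phrased without
  a filtration. As the lattice is countable, this alone gives measurability on path space.\<close>

definition adapted :: "nat \<Rightarrow> ((nat \<Rightarrow> 'a) \<Rightarrow> 'b) \<Rightarrow> bool" where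
  "adapted n F \<longleftrightarrow> (\<forall>S S'. (\<forall>k\<le>n. S k = S' k) \<longrightarrow> F S = F S')"

lemma adaptedI: "(\<And>S S'. (\<And>k. k \<le> n \<Longrightarrow> S k = S' k) \<Longrightarrow> F S = F S') \<Longrightarrow> adapted n F"
  unfolding adapted_def by blast

lemma adaptedD: "adapted n F \<Longrightarrow> (\<And>k. k \<le> n \<Longrightarrow> S k = S' k) \<Longrightarrow> F S = F S'"
  unfolding adapted_def by blast

lemma countable_lattice: "countable (UNIV :: (int ^ 'd::finite) set)"
proof -
  have "inj (vec_nth :: int ^ 'd \<Rightarrow> 'd \<Rightarrow> int)"
    by (simp add: inj_def vec_nth_inject)
  moreover have "countable (UNIV :: ('d \<Rightarrow> int) set)"
    using countable_PiE[of "UNIV :: 'd set" "\<lambda>_. UNIV :: int set"] by simp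
  ultimately show ?thesis
    by (meson countable_image_inj_on countable_subset subset_UNIV)
qed

lemma sets_srw [measurable_cong]: "sets (srw x) = sets paths"
  by (simp add: srw_def)

lemma space_srw [simp]: "space (srw x) = UNIV"
  by (simp add: srw_def space_PiM)

text \<open>A finite product of countable discrete spaces is discrete, so every function of the
  restricted path is measurable, and restricting the path does not change the value of
  \<open>F\<close>.\<close>

lemma measurable_adapted:
  fixes F :: "(nat \<Rightarrow> int ^ 'd::finite) \<Rightarrow> 'b"
  assumes "adapted n F"
  shows "F \<in> measurable paths (count_space UNIV)"
proof -
  have "(\<lambda>S. restrict S {..n}) \<in> measurable (paths :: (nat \<Rightarrow> int ^ 'd) measure)
      (\<Pi>\<^sub>M k\<in>{..n}. count_space UNIV)"
    by (rule measurable_restrict_subset) simp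
  also have "(\<Pi>\<^sub>M k\<in>{..n}. count_space UNIV) =
      count_space (PiE {..n} (\<lambda>_. UNIV :: (int ^ 'd) set))"
    by (intro count_space_PiM_finite countable_lattice) simp
  finally have "(\<lambda>S. F (restrict S {..n})) \<in> measurable paths (count_space UNIV)"
    by (rule measurable_compose) simp
  moreover have "F (restrict S {..n}) = F S" for S
    by (rule adaptedD[OF assms]) simp
  ultimately show ?thesis by simp
qed

lemma measurable_adapted_srw:
  fixes F :: "(nat \<Rightarrow> int ^ 'd::finite) \<Rightarrow> 'b::topological_space"
  assumes "adapted n F"
  shows "F \<in> borel_measurable (srw x)"
  using measurable_compose[OF measurable_adapted[OF assms], of "\<lambda>x. x" borel]
  unfolding measurable_cong_sets[OF sets_srw refl] by simp

lemma sets_adapted_srw: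
  fixes P :: "(nat \<Rightarrow> int ^ 'd::finite) \<Rightarrow> bool"
  assumes "adapted n P"
  shows "{S. P S} \<in> sets (srw x)"
  using measurable_sets[OF measurable_adapted[OF assms], of "{True}"]
  by (simp add: sets_srw space_PiM vimage_def)

text \<open>Resampling a single step preserves the product measure.\<close>

lemma nn_integral_srw_Suc:
  fixes F :: "(nat \<Rightarrow> int ^ 'd::finite) \<Rightarrow> ennreal"
  assumes F: "adapted (Suc n) F"
  shows "(\<integral>\<^sup>+S. F S \<partial>srw x) =
    (\<integral>\<^sup>+S. (\<integral>\<^sup>+s. F (S(Suc n := S n + s)) \<partial>measure_pmf srw_step) \<partial>srw x)"
proof -
  let ?M = "\<Pi>\<^sub>M k\<in>(UNIV::nat set). measure_pmf (srw_step :: (int ^ 'd) pmf)"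
  let ?w = "\<lambda>\<xi> (n::nat). x + (\<Sum>k<n. \<xi> k)"
  have Fm: "F \<in> borel_measurable paths"
    using measurable_compose[OF measurable_adapted[OF F], of "\<lambda>x. x" borel] by simp
  have wm: "?w \<in> measurable ?M paths" by (rule measurable_srw_path)
  have Fw: "(\<lambda>\<xi>. F (?w \<xi>)) \<in> borel_measurable ?M"
    using measurable_compose[OF wm Fm] .
  have upd: "(\<lambda>(s, \<xi>). \<xi>(n := s)) \<in> measurable (measure_pmf srw_step \<Otimes>\<^sub>M ?M) ?M"
    by (rule measurable_PiM_single') (auto simp: space_pair_measure space_PiM case_prod_beta'
        intro!: measurable_compose[OF measurable_snd measurable_component_singleton])
  interpret M: prob_space ?M by (intro prob_space_PiM prob_space_measure_pmf)
  interpret P: pair_sigma_finite "measure_pmf srw_step" ?M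
    by standard
  have eq: "?M = distr (measure_pmf srw_step \<Otimes>\<^sub>M ?M) ?M (\<lambda>(s, \<xi>). \<xi>(n := s))"
    using distr_pair_PiM_eq_PiM[of UNIV "\<lambda>_. measure_pmf (srw_step :: (int ^ 'd) pmf)" n]
    by (simp add: prob_space_measure_pmf)
  \<comment> \<open>The two paths agree only up to time \<open>Suc n\<close>: afterwards one is
    shifted by the new step while the other keeps its old positions. Adaptedness of \<open>F\<close>
    hides the difference.\<close>
  have loc: "F (?w (\<xi>(n := s))) = F ((?w \<xi>)(Suc n := ?w \<xi> n + s))" for \<xi> s
  proof (rule adaptedD[OF F])
    fix k assume k: "k \<le> Suc n"
    have "(\<Sum>j<k. (\<xi>(n := s)) j) = (\<Sum>j<k. \<xi> j)" if "k \<le> n" for k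
      using that by (intro sum.cong) auto
    then show "?w (\<xi>(n := s)) k = ((?w \<xi>)(Suc n := ?w \<xi> n + s)) k"
      using k by (cases "k = Suc n") (auto simp: add.assoc)
  qed
  have gm: "adapted n (\<lambda>S. \<integral>\<^sup>+s. F (S(Suc n := S n + s)) \<partial>measure_pmf srw_step)"
  proof (rule adaptedI)
    fix S S' :: "nat \<Rightarrow> int ^ 'd"
    assume e: "\<And>k. k \<le> n \<Longrightarrow> S k = S' k"
    have "F (S(Suc n := S n + s)) = F (S'(Suc n := S' n + s))" for s
      using e by (intro adaptedD[OF F]) auto
    then show "(\<integral>\<^sup>+s. F (S(Suc n := S n + s)) \<partial>measure_pmf srw_step) =
        (\<integral>\<^sup>+s. F (S'(Suc n := S' n + s)) \<partial>measure_pmf srw_step)" by simp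
  qed
  have "(\<integral>\<^sup>+S. F S \<partial>srw x) = (\<integral>\<^sup>+\<xi>. F (?w \<xi>) \<partial>?M)"
    unfolding srw_def by (rule nn_integral_distr[OF wm]) (simp add: Fm)
  also have "\<dots> = (\<integral>\<^sup>+\<xi>. F (?w \<xi>) \<partial>distr (measure_pmf srw_step \<Otimes>\<^sub>M ?M) ?M (\<lambda>(s, \<xi>). \<xi>(n := s)))"
    by (simp only: eq[symmetric])
  also have "\<dots> = (\<integral>\<^sup>+p. F (?w ((\<lambda>(s, \<xi>). \<xi>(n := s)) p)) \<partial>(measure_pmf srw_step \<Otimes>\<^sub>M ?M))"
    by (rule nn_integral_distr[OF upd]) (simp add: Fw)
  also have "\<dots> = (\<integral>\<^sup>+\<xi>. (\<integral>\<^sup>+s. F (?w (\<xi>(n := s))) \<partial>measure_pmf srw_step) \<partial>?M)"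
    using P.nn_integral_snd[OF measurable_compose[OF upd Fw]] by simp
  also have "\<dots> = (\<integral>\<^sup>+\<xi>. (\<integral>\<^sup>+s. F ((?w \<xi>)(Suc n := ?w \<xi> n + s)) \<partial>measure_pmf srw_step) \<partial>?M)"
    by (simp only: loc)
  also have "\<dots> = (\<integral>\<^sup>+S. (\<integral>\<^sup>+s. F (S(Suc n := S n + s)) \<partial>measure_pmf srw_step) \<partial>srw x)"
    unfolding srw_def
    by (rule nn_integral_distr[OF wm, symmetric])
       (use measurable_compose[OF measurable_adapted[OF gm], of "\<lambda>x. x" borel] in simp)
  finally show ?thesis .
qed

lemma AE_srw_0: "AE S in srw x. S 0 = x"
proof -
  have "{S \<in> space paths. S 0 = x} \<in> sets (paths :: (nat \<Rightarrow> int ^ 'a) measure)"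
    using sets_adapted_srw[of 0 "\<lambda>S. S 0 = x" x] by (simp add: adapted_def sets_srw space_PiM)
  then show ?thesis
    unfolding srw_def by (subst AE_distr_iff[OF measurable_srw_path]) simp_all
qed

lemma nn_integral_srw_0:
  fixes F :: "(nat \<Rightarrow> int ^ 'd::finite) \<Rightarrow> ennreal"
  assumes F: "adapted 0 F"
  shows "(\<integral>\<^sup>+S. F S \<partial>srw x) = F (\<lambda>_. x)"
proof -
  interpret prob_space "srw x" by (rule prob_space_srw)
  have "(\<integral>\<^sup>+S. F S \<partial>srw x) = (\<integral>\<^sup>+S. F (\<lambda>_. x) \<partial>srw x)"
  proof (rule nn_integral_cong_AE)
    show "AE S in srw x. F S = F (\<lambda>_. x)"
      using AE_srw_0[of x]
    proof eventually_elim
      case (elim S)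
      show ?case by (rule adaptedD[OF F]) (use elim in simp)
    qed
  qed
  then show ?thesis using emeasure_space_1 by simp
qed

section \<open>The law of a single step\<close>

lemma set_pmf_srw_step:
  "set_pmf srw_step = range (\<lambda>i. axis i 1) \<union> range (\<lambda>i. axis i (-1))"
  unfolding srw_step_def by (rule set_pmf_of_set) auto

lemma expectation_srw_step:
  fixes f :: "int ^ 'd::finite \<Rightarrow> real"
  shows "measure_pmf.expectation srw_step f =
    (\<Sum>i\<in>UNIV. f (axis i 1) + f (axis i (-1))) / (2 * CARD('d))"
proof -
  let ?A = "range (\<lambda>i. axis i 1 :: int ^ 'd)" and ?B = "range (\<lambda>i. axis i (-1) :: int ^ 'd)"
  have ia: "inj (\<lambda>i. axis i 1 :: int ^ 'd)" and ib: "inj (\<lambda>i. axis i (-1) :: int ^ 'd)"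
    by (auto simp: inj_def axis_eq_axis)
  have d: "?A \<inter> ?B = {}" by (auto simp: axis_eq_axis)
  have "card (?A \<union> ?B) = 2 * CARD('d)"
    by (subst card_Un_disjoint) (use d ia ib in \<open>auto simp: card_image\<close>)
  moreover have "sum f (?A \<union> ?B) = (\<Sum>i\<in>UNIV. f (axis i 1)) + (\<Sum>i\<in>UNIV. f (axis i (-1)))"
    by (subst sum.union_disjoint) (use d ia ib in \<open>auto simp: sum.reindex\<close>)
  ultimately show ?thesis
    unfolding srw_step_def by (subst integral_pmf_of_set) (auto simp: sum.distrib)
qed

section \<open>A superharmonic substitute for the Green function\<close>

text \<open>
  The shift 100 makes the second-order term of the discrete Laplacian of \<open>bump x powr (-1/2)\<close>
  dominate the Taylor remainder, and the factor 4000 makes the drop at the origin at least 1.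
\<close>

definition bump :: "int ^ 3 \<Rightarrow> real" where
  "bump x = 100 + (\<Sum>i\<in>UNIV. (real_of_int (x $ i))\<^sup>2)"

definition green :: "int ^ 3 \<Rightarrow> real" where
  "green x = 4000 / sqrt (bump x)"

lemma bump_ge: "bump x \<ge> 100"
  by (simp add: bump_def sum_nonneg)

lemma bump_pos [simp]: "bump x > 0"
  using bump_ge[of x] by linarith

lemma sq_le_bump: "(real_of_int (x $ i))\<^sup>2 + 100 \<le> bump x"
  using member_le_sum[of i UNIV "\<lambda>i. (real_of_int (x $ i))\<^sup>2"] by (simp add: bump_def)

lemma bump_step: "bump (x + axis i c) = bump x + 2 * c * x $ i + (real_of_int c)\<^sup>2"
proof -
  have "(real_of_int ((x + axis i c) $ j))\<^sup>2 = (real_of_int (x $ j))\<^sup>2 +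
      (if j = i then 2 * c * x $ i + (real_of_int c)\<^sup>2 else 0)" for j
    by (auto simp: axis_def power2_eq_square algebra_simps)
  then show ?thesis by (simp add: bump_def sum.distrib)
qed

text \<open>The Taylor polynomial of third order, with the next coefficient 35/128 raised to 1 to
  absorb the remainder. Squaring reduces the claim to \<open>P\<^sup>2 * (1 + s) \<ge> 1\<close>,
  where the difference is \<open>s^4\<close> times a polynomial that is nonnegative on the
  interval.\<close>

lemma inverse_sqrt_le:
  fixes s :: real
  assumes "\<bar>s\<bar> \<le> 1/4"
  shows "1 / sqrt (1 + s) \<le> 1 - s / 2 + 3 / 8 * s^2 - 5 / 16 * s^3 + s^4"
proof -
  define P where "P = 1 - s / 2 + 3 / 8 * s^2 - 5 / 16 * s^3 + s^4"
  have s: "-1/4 \<le> s" "s \<le> 1/4" using assms by auto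
  have a: "\<bar>s ^ k\<bar> \<le> 1/4" if "k > 0" for k
  proof -
    have "\<bar>s\<bar> ^ k \<le> \<bar>s\<bar> ^ 1" using that assms by (intro power_decreasing) auto
    then show ?thesis using assms by (simp add: power_abs)
  qed
  have P: "P > 0"
  proof -
    have "s^2 \<ge> 0" "s^4 \<ge> 0" "s^3 \<le> 1/4" using a[of 3] by auto
    then show ?thesis using s unfolding P_def by linarith
  qed
  have q: "93/64 + 78/64 * s - 99/256 * s^2 + 57/256 * s^3 + 3/8 * s^4 + s^5 \<ge> 0"
  proof -
    have "s^4 \<ge> 0" "s^2 \<le> 1/4" "s^3 \<ge> -1/4" "s^5 \<ge> -1/4" using a[of 2] a[of 3] a[of 5] by auto
    then show ?thesis using s by linarith
  qed
  have "P\<^sup>2 * (1 + s) - 1 = s^4 * (93/64 + 78/64 * s - 99/256 * s^2 + 57/256 * s^3 + 3/8 * s^4 + s^5)"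
    unfolding P_def by (simp add: power2_eq_square field_simps eval_nat_numeral)
  also have "\<dots> \<ge> 0" using q by simp
  finally have "1 \<le> P\<^sup>2 * (1 + s)" by simp
  then have "sqrt 1 \<le> sqrt (P\<^sup>2 * (1 + s))" by (rule real_sqrt_le_mono)
  also have "\<dots> = P * sqrt (1 + s)" using P by (simp add: real_sqrt_mult)
  finally show ?thesis using s unfolding P_def[symmetric] by (simp add: divide_le_eq)
qed

text \<open>A unit step changes \<open>bump\<close> by at most a quarter of its value, so the
  relative change stays in the range of \<open>inverse_sqrt_le\<close>.\<close>

lemma two_abs_le_bump: "1 + 2 * \<bar>real_of_int (x $ i)\<bar> \<le> bump x / 4"
proof -
  have "0 \<le> (\<bar>real_of_int (x $ i)\<bar> - 4)\<^sup>2" by simp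
  then show ?thesis using sq_le_bump[of x i] by (simp add: power2_diff)
qed

text \<open>The relative changes \<open>s\<close> and \<open>t\<close> for the two opposite steps
  differ only in the sign of \<open>u\<close>, so odd powers of \<open>u\<close> cancel in the sum
  of the two expansions.\<close>

lemma sum_inverse_sqrt_bump_step:
  "1 / sqrt (bump (x + axis i 1)) + 1 / sqrt (bump (x + axis i (-1)))
    \<le> (2 - 1 / bump x + (3 / 4 + 3 * (real_of_int (x $ i))\<^sup>2) / (bump x)\<^sup>2 + 33 / (bump x)\<^sup>2)
      / sqrt (bump x)"
proof -
  define R u where "R = bump x" and "u = 2 * real_of_int (x $ i)"
  have R: "R \<ge> 100" using bump_ge[of x] by (simp add: R_def)
  have u: "1 + \<bar>u\<bar> \<le> R / 4" using two_abs_le_bump[of x i] by (simp add: R_def u_def abs_mult)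
  have u2: "u\<^sup>2 \<le> 4 * R" using sq_le_bump[of x i] by (simp add: R_def u_def power_mult_distrib)
  define s t where "s = (1 + u) / R" and "t = (1 - u) / R"
  have st: "\<bar>s\<bar> \<le> 1/4" "\<bar>t\<bar> \<le> 1/4" 
  proof -
    have "\<bar>1 + u\<bar> \<le> R / 4" "\<bar>1 - u\<bar> \<le> R / 4" using u by linarith+
    then show "\<bar>s\<bar> \<le> 1/4" "\<bar>t\<bar> \<le> 1/4"
      using R unfolding s_def t_def abs_divide by (simp_all add: divide_le_eq)
  qed
  have "bump (x + axis i 1) = R * (1 + s)" "bump (x + axis i (-1)) = R * (1 + t)"
    using R by (auto simp: bump_step R_def[symmetric] s_def t_def u_def field_simps)
  then have "1 / sqrt (bump (x + axis i 1)) + 1 / sqrt (bump (x + axis i (-1)))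
      = (1 / sqrt (1 + s) + 1 / sqrt (1 + t)) / sqrt R"
    by (simp only: real_sqrt_mult add_divide_distrib divide_divide_eq_left mult.commute)
  also have "\<dots> \<le> ((1 - s / 2 + 3 / 8 * s^2 - 5 / 16 * s^3 + s^4) +
      (1 - t / 2 + 3 / 8 * t^2 - 5 / 16 * t^3 + t^4)) / sqrt R"
    using inverse_sqrt_le[OF st(1)] inverse_sqrt_le[OF st(2)] R by (intro divide_right_mono) auto
  also have "\<dots> \<le> (2 - 1 / R + (3 / 4 + 3 / 4 * u\<^sup>2) / R\<^sup>2 + 33 / R\<^sup>2) / sqrt R"
  proof (rule divide_right_mono)
    have e1: "s + t = 2 / R" by (simp add: s_def t_def add_divide_distrib[symmetric])
    have e2: "s^2 + t^2 = (2 + 2 * u\<^sup>2) / R\<^sup>2"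
      using R by (simp add: s_def t_def power_divide power2_eq_square field_simps)
    have e3: "s^3 + t^3 = (2 + 6 * u\<^sup>2) / R^3"
      unfolding s_def t_def power_divide add_divide_distrib[symmetric]
      by (simp add: eval_nat_numeral algebra_simps)
    have e4: "s^4 + t^4 = (2 + 12 * u\<^sup>2 + 2 * (u\<^sup>2)\<^sup>2) / R^4"
      unfolding s_def t_def power_divide add_divide_distrib[symmetric]
      by (simp add: eval_nat_numeral algebra_simps)
    \<comment> \<open>As \<open>u\<^sup>2 \<le> 4 * R\<close>, the leading part is
      \<open>32 * R\<^sup>2\<close>; one more \<open>R\<^sup>2\<close> absorbs the lower terms
      because \<open>R \<ge> 100\<close>.\<close>
    have "2 + 12 * u\<^sup>2 + 2 * (u\<^sup>2)\<^sup>2 \<le> 2 + 12 * (4 * R) + 2 * (4 * R)\<^sup>2"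
      using u2 by (intro add_mono mult_left_mono power_mono) auto
    also have "\<dots> \<le> 33 * R\<^sup>2"
    proof -
      have "100 * R \<le> R * R" using R by (intro mult_right_mono) auto
      then have "2 + 48 * R \<le> R * R" using R by linarith
      then show ?thesis by (simp add: power2_eq_square)
    qed
    finally have "s^4 + t^4 \<le> 33 * R\<^sup>2 / R^4"
      unfolding e4 using R by (intro divide_right_mono) auto
    also have "\<dots> = 33 / R\<^sup>2" using R by (simp add: field_simps eval_nat_numeral)
    finally have f4: "s^4 + t^4 \<le> 33 / R\<^sup>2" .
    \<comment> \<open>The cubic terms enter with a negative coefficient, so their sign is all that
      matters.\<close>
    have f3: "0 \<le> s^3 + t^3" unfolding e3 using R by simp
    have f2: "3 / 8 * s^2 + 3 / 8 * t^2 = (3 / 4 + 3 / 4 * u\<^sup>2) / R\<^sup>2"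
      using arg_cong[OF e2, of "\<lambda>v. 3 / 8 * v"] by (simp add: algebra_simps)
    show "(1 - s / 2 + 3 / 8 * s^2 - 5 / 16 * s^3 + s^4) + (1 - t / 2 + 3 / 8 * t^2 - 5 / 16 * t^3 + t^4)
        \<le> 2 - 1 / R + (3 / 4 + 3 / 4 * u\<^sup>2) / R\<^sup>2 + 33 / R\<^sup>2"
      using e1 f2 f3 f4 by (simp add: algebra_simps)
  qed (use R in simp)
  finally show ?thesis by (simp add: R_def u_def power_mult_distrib)
qed

text \<open>Summed over the three directions, the terms of order 1/R cancel, which reflects that
  1/|x| is harmonic in dimension 3. The shift leaves -300/R^2, and this beats the remainder (9/4 +
  99)/R^2.\<close>

lemma green_superharmonic:
  "measure_pmf.expectation srw_step (\<lambda>s. green (x + s)) \<le> green x - of_bool (x = 0)"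
proof -
  define R where "R = bump x"
  have R: "R \<ge> 100" using bump_ge[of x] by (simp add: R_def)
  have S: "(\<Sum>i\<in>UNIV. (real_of_int (x $ i))\<^sup>2) = R - 100" by (simp add: R_def bump_def)
  have "(\<Sum>i\<in>UNIV. 1 / sqrt (bump (x + axis i 1)) + 1 / sqrt (bump (x + axis i (-1))))
      \<le> (\<Sum>i\<in>UNIV. (2 - 1 / R + (3 / 4 + 3 * (real_of_int (x $ i))\<^sup>2) / R\<^sup>2 + 33 / R\<^sup>2) / sqrt R)"
    unfolding R_def by (intro sum_mono sum_inverse_sqrt_bump_step)
  also have "\<dots> = (6 - 3 / R + (9 / 4 + 3 * (\<Sum>i\<in>UNIV. (real_of_int (x $ i))\<^sup>2)) / R\<^sup>2 + 99 / R\<^sup>2) / sqrt R"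
    by (simp add: sum.distrib sum_divide_distrib[symmetric] sum_distrib_left[symmetric] sum_subtractf)
  also have "\<dots> = (6 - (198 + 3/4) / R\<^sup>2) / sqrt R"
    unfolding S using R by (simp add: field_simps power2_eq_square)
  finally have le: "(\<Sum>i\<in>UNIV. 1 / sqrt (bump (x + axis i 1)) + 1 / sqrt (bump (x + axis i (-1))))
      \<le> (6 - (198 + 3/4) / R\<^sup>2) / sqrt R" .
  have "measure_pmf.expectation srw_step (\<lambda>s. green (x + s)) =
    4000 / 6 * (\<Sum>i\<in>UNIV. 1 / sqrt (bump (x + axis i 1)) + 1 / sqrt (bump (x + axis i (-1))))"
    by (simp add: expectation_srw_step green_def sum_distrib_left sum_divide_distrib add_divide_distrib algebra_simps)
  also have "\<dots> \<le> 4000 / 6 * ((6 - (198 + 3/4) / R\<^sup>2) / sqrt R)"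
    by (intro mult_left_mono le) simp
  \<comment> \<open>At the origin \<open>R = 100\<close> and the drop equals 1.325; elsewhere only
    its sign is needed.\<close>
  also have "\<dots> \<le> 4000 / sqrt R - of_bool (x = 0)"
  proof (cases "x = 0")
    case True
    then have "R = 10\<^sup>2" by (simp add: R_def bump_def)
    then have "R = 100" "sqrt R = 10" by (simp, simp only: real_sqrt_abs)
    then show ?thesis by (simp add: True)
  next
    case False
    then show ?thesis using R by (simp add: field_simps)
  qed
  finally show ?thesis by (simp add: green_def R_def)
qed

section \<open>Size and gradient of the kernel\<close>

lemma green_pos: "green x > 0"
  by (simp add: green_def)

lemma green_0: "green 0 = 400"
proof -
  have "bump 0 = 10\<^sup>2" by (simp add: bump_def)
  then have "sqrt (bump 0) = 10" by (simp only: real_sqrt_abs)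
  then show ?thesis by (simp add: green_def)
qed

text \<open>A unit step changes \<open>sqrt (bump x)\<close> by at most 3/2, hence its reciprocal by
  the order of \<open>1 / bump x\<close>.\<close>

lemma green_gradient:
  assumes "s \<in> set_pmf srw_step"
  shows "\<bar>green (x + s) - green x\<bar> \<le> 12000 / bump x"
proof -
  obtain i c where s: "s = axis i c" and c: "c = 1 \<or> c = -1"
    using assms by (auto simp: set_pmf_srw_step)
  define R R' p q where "R = bump x" and "R' = bump (x + s)" and "p = sqrt R" and "q = sqrt R'"
  have R: "R \<ge> 100" "R' \<ge> 100" using bump_ge by (auto simp: R_def R'_def)
  have p: "p > 0" "q > 0" "p\<^sup>2 = R" "q\<^sup>2 = R'" using R by (auto simp: p_def q_def)
  have p10: "p \<ge> 10" using real_le_rsqrt[of 10 R] R by (simp add: p_def)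
  have xp: "\<bar>real_of_int (x $ i)\<bar> \<le> p"
    using sq_le_bump[of x i] unfolding p_def R_def by (intro real_le_rsqrt) auto
  have d: "R' - R = 2 * c * x $ i + 1" using c by (auto simp: R'_def R_def s bump_step)
  have "\<bar>R' - R\<bar> \<le> 1 + 2 * \<bar>real_of_int (x $ i)\<bar>" using c unfolding d by auto
  then have dR: "\<bar>R' - R\<bar> \<le> 22 / 10 * p" "\<bar>R' - R\<bar> \<le> R / 4"
    using xp p10 two_abs_le_bump[of x i] by (auto simp: R_def)
  \<comment> \<open>This keeps \<open>q + p\<close> above 3/2 p, so the bound on
    \<open>R' - R\<close> turns into one on \<open>q - p\<close>, and it keeps \<open>q * p\<close>
    comparable with \<open>R\<close>.\<close>
  have "p / 2 \<le> q"
  proof -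
    have "R / 4 \<le> R'" using dR(2) R by linarith
    then have "sqrt (R / 4) \<le> sqrt R'" by (rule real_sqrt_le_mono)
    then show ?thesis by (simp add: p_def q_def real_sqrt_divide)
  qed
  have "(q - p) * (q + p) = R' - R" using p by (simp add: algebra_simps power2_eq_square)
  then have "\<bar>q - p\<bar> * (q + p) = \<bar>R' - R\<bar>" using p by (metis abs_mult abs_of_pos add_pos_pos)
  moreover have "\<bar>q - p\<bar> * (3 / 2 * p) \<le> \<bar>q - p\<bar> * (q + p)"
    using \<open>p / 2 \<le> q\<close> by (intro mult_left_mono) auto
  ultimately have "(\<bar>q - p\<bar> * (3 / 2)) * p \<le> (22 / 10) * p"
    using dR(1) by (simp add: mult.assoc)
  then have "\<bar>q - p\<bar> * (3 / 2) \<le> 22 / 10" using p by (simp only: mult_le_cancel_right_pos)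
  then have qp: "\<bar>q - p\<bar> \<le> 3 / 2" by simp
  have "green (x + s) - green x = 4000 * (1 / q - 1 / p)"
    by (simp add: green_def R_def R'_def p_def q_def algebra_simps)
  then have "\<bar>green (x + s) - green x\<bar> = 4000 * \<bar>1 / q - 1 / p\<bar>"
    by (simp only: abs_mult abs_numeral)
  also have "\<bar>1 / q - 1 / p\<bar> = \<bar>q - p\<bar> / (q * p)"
    using p by (simp add: field_simps abs_minus_commute abs_div abs_mult divide_simps)
  also have "\<dots> \<le> \<bar>q - p\<bar> / (p / 2 * p)"
    using \<open>p / 2 \<le> q\<close> p by (intro divide_left_mono mult_right_mono) auto
  finally have 1: "\<bar>green (x + s) - green x\<bar> \<le> 4000 * (\<bar>q - p\<bar> / (p / 2 * p))" by simp
  have "4000 * (\<bar>q - p\<bar> / (p / 2 * p)) \<le> 4000 * (3 / 2 / (p / 2 * p))"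
    using p qp by (intro mult_left_mono divide_right_mono) auto
  also have "\<dots> = 12000 / R" using p by (simp add: power2_eq_square)
  finally show ?thesis using 1 by (simp add: R_def)
qed

section \<open>Lattice sums of the gradient kernel\<close>

lemma finite_card_vec_PiE:
  fixes A :: "'n::finite \<Rightarrow> 'a set"
  assumes "\<And>i. finite (A i)"
  shows "finite {x :: 'a ^ 'n. \<forall>i. x $ i \<in> A i}" "card {x :: 'a ^ 'n. \<forall>i. x $ i \<in> A i} = (\<Prod>i\<in>UNIV. card (A i))"
proof -
  have b: "bij_betw vec_nth {x :: 'a ^ 'n. \<forall>i. x $ i \<in> A i} (PiE UNIV A)"
    by (rule bij_betw_byWitness[of _ vec_lambda]) (auto simp: PiE_def)
  show "finite {x :: 'a ^ 'n. \<forall>i. x $ i \<in> A i}"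
    using bij_betw_finite[OF b] assms by (simp add: finite_PiE)
  show "card {x :: 'a ^ 'n. \<forall>i. x $ i \<in> A i} = (\<Prod>i\<in>UNIV. card (A i))"
    using bij_betw_same_card[OF b] by (simp add: card_PiE)
qed

text \<open>The sup norm plus one: the offset keeps the index positive, so that negative powers of
  it make sense at the origin too.\<close>

definition shell :: "int ^ 3 \<Rightarrow> nat" where
  "shell x = Suc (nat (Max (range (\<lambda>i. \<bar>x $ i\<bar>))))"

lemma shell_attained: "\<exists>i. \<bar>x $ i\<bar> = int (shell x - 1)"
proof -
  have "Max (range (\<lambda>i. \<bar>x $ i\<bar>)) \<in> range (\<lambda>i. \<bar>x $ i\<bar>)" by (rule Max_in) auto
  then obtain i where "Max (range (\<lambda>i. \<bar>x $ i\<bar>)) = \<bar>x $ i\<bar>" by blast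
  then show ?thesis by (intro exI[of _ i]) (simp add: shell_def)
qed

lemma abs_le_shell: "\<bar>x $ i\<bar> \<le> int (shell x - 1)"
proof -
  have "\<bar>x $ i\<bar> \<le> Max (range (\<lambda>i. \<bar>x $ i\<bar>))" by (rule Max_ge) auto
  moreover have "0 \<le> \<bar>x $ i\<bar>" by simp
  ultimately show ?thesis unfolding shell_def by linarith
qed

lemma shell_pos [simp]: "shell x > 0"
  by (simp add: shell_def)

text \<open>A shell is covered by three pairs of opposite faces of a cube. In a pair one coordinate
  takes at most 2 values and the other two at most \<open>2 * m\<close> each, which gives
  \<open>8 * m\<^sup>2\<close> points.\<close>

lemma card_shell: "finite {x. shell x = m}" "card {x. shell x = m} \<le> 24 * m\<^sup>2"
proof -
  define k where "k = int (m - 1)"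
  define A where "A i j = (if j = i then {-k, k} else {-k..k})" for i j :: 3
  let ?B = "\<lambda>i. {x :: int ^ 3. \<forall>j. x $ j \<in> A i j}"
  have fA: "finite (A i j)" for i j by (simp add: A_def)
  have sub: "{x. shell x = m} \<subseteq> (\<Union>i. ?B i)"
  proof
    fix x assume "x \<in> {x. shell x = m}"
    then have m: "shell x = m" by simp
    obtain i where i: "\<bar>x $ i\<bar> = k" using shell_attained[of x] m by (auto simp: k_def)
    have j: "\<bar>x $ j\<bar> \<le> k" for j using abs_le_shell[of x j] m by (simp add: k_def)
    have "x $ j \<in> A i j" for j
    proof (cases "j = i")
      case True
      have "x $ i = - k \<or> x $ i = k" using i by linarith
      then show ?thesis using True by (simp add: A_def)
    next
      case False
      have "- k \<le> x $ j" "x $ j \<le> k" using j[of j] by linarith+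
      then show ?thesis using False by (simp add: A_def)
    qed
    then show "x \<in> (\<Union>i. ?B i)" by auto
  qed
  have fin: "finite (\<Union>i. ?B i)" using finite_card_vec_PiE(1)[OF fA] by auto
  show "finite {x. shell x = m}" using finite_subset[OF sub fin] .
  show "card {x. shell x = m} \<le> 24 * m\<^sup>2"
  proof (cases "m = 0")
    case True
    have "{x. shell x = m} = {}" using True by (simp add: shell_def)
    then show ?thesis by simp
  next
    case False
    have cB: "card (?B i) \<le> 8 * m\<^sup>2" for i
    proof -
      have le: "card (A i j) \<le> (if j = i then 2 else 2 * m)" for j
      proof -
        have "card {-k, k} \<le> 2" by (simp add: card_insert_if)
        moreover have "card {-k..k} \<le> 2 * m" using False by (simp add: k_def nat_le_iff)
        ultimately show ?thesis by (simp add: A_def)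
      qed
      have "card (?B i) = (\<Prod>j\<in>UNIV. card (A i j))" by (rule finite_card_vec_PiE(2)[OF fA])
      also have "\<dots> \<le> (\<Prod>j\<in>UNIV. if j = i then 2 else 2 * m)"
      proof (rule prod_mono)
        fix j
        show "0 \<le> card (A i j) \<and> card (A i j) \<le> (if j = i then 2 else 2 * m)"
          using le[of j] by blast
      qed
      also have "\<dots> = 2 * (\<Prod>j\<in>UNIV - {i}. 2 * m)"
        by (subst prod.remove[of _ i]) (auto intro!: prod.cong)
      also have "\<dots> = 8 * m\<^sup>2"
        by (simp add: power_mult_distrib)
      finally show ?thesis .
    qed
    have "card {x. shell x = m} \<le> card (\<Union>i. ?B i)" by (rule card_mono[OF fin sub])
    also have "\<dots> \<le> (\<Sum>i\<in>UNIV. card (?B i))" by (rule card_UN_le) simp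
    also have "\<dots> \<le> (\<Sum>i\<in>(UNIV :: 3 set). 8 * m\<^sup>2)" by (rule sum_mono[OF cB])
    finally show ?thesis by simp
  qed
qed

lemma sum_shell_le:
  fixes \<phi> :: "nat \<Rightarrow> real"
  assumes "finite F" "\<And>m. \<phi> m \<ge> 0"
  shows "(\<Sum>x\<in>F. \<phi> (shell x)) \<le> (\<Sum>m\<in>shell ` F. 24 * (real m)\<^sup>2 * \<phi> m)"
proof -
  have "(\<Sum>x\<in>F. \<phi> (shell x)) = (\<Sum>m\<in>shell ` F. \<Sum>x\<in>{x\<in>F. shell x = m}. \<phi> (shell x))"
    by (rule sum.image_gen[OF assms(1)])
  also have "\<dots> \<le> (\<Sum>m\<in>shell ` F. 24 * (real m)\<^sup>2 * \<phi> m)"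
  proof (rule sum_mono)
    fix m
    have "card {x\<in>F. shell x = m} \<le> card {x. shell x = m}"
      by (rule card_mono) (auto simp: card_shell)
    also have "\<dots> \<le> 24 * m\<^sup>2" by (rule card_shell)
    finally have "real (card {x\<in>F. shell x = m}) \<le> real (24 * m\<^sup>2)"
      by (simp only: of_nat_le_iff)
    then have "real (card {x\<in>F. shell x = m}) \<le> 24 * (real m)\<^sup>2" by simp
    then show "(\<Sum>x\<in>{x\<in>F. shell x = m}. \<phi> (shell x)) \<le> 24 * (real m)\<^sup>2 * \<phi> m"
      using assms(2) by (simp add: mult_right_mono)
  qed
  finally show ?thesis .
qed

lemma shell_sq_le_bump: "(real (shell x))\<^sup>2 \<le> 2 * bump x"
proof -
  obtain i where i: "\<bar>x $ i\<bar> = int (shell x - 1)" using shell_attained by blast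
  define a where "a = \<bar>real_of_int (x $ i)\<bar>"
  have "a = real (shell x) - 1"
    using arg_cong[OF i, of real_of_int] shell_pos[of x] unfolding a_def by (simp add: of_nat_diff)
  then have "real (shell x) = a + 1" by simp
  moreover have "(a + 1)\<^sup>2 \<le> 2 * (a\<^sup>2 + 100)"
    using zero_le_power2[of "a - 1"] by (simp add: power2_eq_square algebra_simps)
  ultimately show ?thesis using sq_le_bump[of x i] unfolding a_def by simp
qed

section \<open>Power sums over the shells\<close>

lemma sum_powr_le:
  fixes N :: nat
  shows "(\<Sum>m\<in>{1..N}. real m powr (-2/3)) \<le> 3 * real N powr (1/3)"
proof (induction N)
  case (Suc N)
  define a b where "a = real (Suc N) powr (1/3)" and "b = real N powr (1/3)"
  have ab: "0 \<le> b" "b \<le> a" "0 < a" by (auto simp: a_def b_def powr_mono2)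
  have "a ^ 3 = real (Suc N)" "b ^ 3 = real N"
    by (cases "N = 0"; simp add: a_def b_def powr_power)+
  \<comment> \<open>Telescoping with cube roots: the difference of consecutive cubes is 1, and the
    second factor is at most \<open>3 * a\<^sup>2\<close>.\<close>
  then have "1 = (a - b) * (a\<^sup>2 + a * b + b\<^sup>2)"
    by (simp add: power2_eq_square power3_eq_cube algebra_simps)
  also have "\<dots> \<le> (a - b) * (a\<^sup>2 + a\<^sup>2 + a\<^sup>2)"
    using ab by (intro mult_left_mono add_mono) (auto simp: power2_eq_square intro: mult_mono)
  finally have "1 / a\<^sup>2 \<le> 3 * (a - b)" using ab by (simp add: field_simps)
  moreover have "1 / a\<^sup>2 = real (Suc N) powr (-2/3)"
    unfolding a_def by (simp add: powr_power powr_minus divide_simps)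
  ultimately show ?case using Suc.IH by (simp add: a_def b_def)
qed simp

lemma sum_inverse_squares_le:
  fixes \<rho> :: real
  assumes "finite M" "\<And>m. m \<in> M \<Longrightarrow> \<rho> < real m" "\<rho> > 0"
  shows "(\<Sum>m\<in>M. 1 / (real m)\<^sup>2) \<le> 2 / \<rho>"
proof -
  \<comment> \<open>The least natural number exceeding \<open>\<rho>\<close>, so the sum runs over
    indices from \<open>a\<close> on.\<close>
  define a where "a = Suc (nat \<lfloor>\<rho>\<rfloor>)"
  have "real a = real_of_int \<lfloor>\<rho>\<rfloor> + 1" using assms(3) by (simp add: a_def)
  then have a1: "\<rho> < real a" by simp
  have a: "a \<le> m" if "\<rho> < real m" for m
    using that assms(3) unfolding a_def by (simp add: Suc_le_eq nat_less_iff floor_less_iff)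
  obtain N where N: "\<And>m. m \<in> M \<Longrightarrow> m < N" using assms(1) unfolding finite_nat_set_iff_bounded by auto
  have tel: "(\<Sum>m\<in>{a..<b}. 1 / (real m)\<^sup>2) \<le> 2 / real a - 2 / real b" if "a \<le> b" for b
    using that
  proof (induction b rule: dec_induct)
    case (step b)
    have b: "b \<ge> 1" using step by (simp add: a_def)
    \<comment> \<open>The right side is 2/(b (b + 1)), and b + 1 is at most 2 b.\<close>
    have "1 / (real b)\<^sup>2 \<le> 2 / real b - 2 / real (Suc b)"
      using b by (simp add: divide_simps power2_eq_square)
    then show ?case using step by simp
  qed simp
  have "(\<Sum>m\<in>M. 1 / (real m)\<^sup>2) \<le> (\<Sum>m\<in>{a..<max a N}. 1 / (real m)\<^sup>2)"
    using a assms N by (intro sum_mono2) (auto simp: less_max_iff_disj)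
  also have "\<dots> \<le> 2 / real a" 
  proof -
    have "0 \<le> 2 / real (max a N)" by simp
    then show ?thesis using tel[of "max a N"] by linarith
  qed
  also have "\<dots> \<le> 2 / \<rho>"
    using assms(3) a1 by (intro divide_left_mono mult_pos_pos) auto
  finally show ?thesis .
qed

text \<open>A shell of index m holds order m^2 points, each contributing order m^(-8/3), so the sum
  is that of m^(-2/3) up to \<open>\<rho>\<close>. The constant is 24 * 3 * 3.\<close>

lemma sum_near_le:
  fixes \<rho> :: real
  assumes "finite F" "\<rho> > 0"
  shows "(\<Sum>x\<in>F. if shell x \<le> \<rho> then bump x powr (-4/3) else 0) \<le> 216 * \<rho> powr (1/3)"
proof -
  define \<phi> where "\<phi> m = (if real m \<le> \<rho> then 3 * real m powr (-8/3) else 0)" for m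
  have "bump x powr (-4/3) \<le> 3 * real (shell x) powr (-8/3)" for x
  proof -
    have p: "(real (shell x))\<^sup>2 / 2 \<le> bump x" using shell_sq_le_bump[of x] by simp
    have "bump x powr (-4/3) \<le> ((real (shell x))\<^sup>2 / 2) powr (-4/3)"
      using p by (intro powr_mono2') auto
    also have "(real (shell x))\<^sup>2 / 2 = real (shell x) powr 2 * (1/2)" by simp
    also have "\<dots> powr (-4/3) = (real (shell x)) powr (-8/3) * (1/2) powr (-4/3)"
      by (subst powr_mult) (simp_all only: powr_powr, simp_all)
    also have "\<dots> \<le> (real (shell x)) powr (-8/3) * 3"
    proof (rule mult_left_mono)
      have "(1/2 :: real) powr (-4/3) = 2 powr (4/3)" by (simp add: powr_minus_divide powr_divide)
      also have "\<dots> \<le> 2 powr (3/2)" by (intro powr_mono) auto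
      also have "\<dots> = 2 powr 1 * 2 powr (1/2)" by (subst powr_add[symmetric]) simp
      also have "\<dots> = 2 * sqrt 2" by (simp add: powr_half_sqrt)
      also have "\<dots> \<le> 3" using real_sqrt_le_mono[of 2 "(3/2)\<^sup>2"] by (simp add: power2_eq_square real_sqrt_divide)
      finally show "(1/2 :: real) powr (-4/3) \<le> 3" .
    qed simp
    finally show ?thesis by simp
  qed
  then have "(\<Sum>x\<in>F. if shell x \<le> \<rho> then bump x powr (-4/3) else 0) \<le> (\<Sum>x\<in>F. \<phi> (shell x))"
    by (intro sum_mono) (auto simp: \<phi>_def)
  also have "\<dots> \<le> (\<Sum>m\<in>shell ` F. 24 * (real m)\<^sup>2 * \<phi> m)"
    by (rule sum_shell_le[OF assms(1)]) (simp add: \<phi>_def)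
  also have "\<dots> = (\<Sum>m\<in>{m\<in>shell ` F. real m \<le> \<rho>}. 72 * real m powr (-2/3))"
  proof -
    have "24 * (real m)\<^sup>2 * \<phi> m = (if real m \<le> \<rho> then 72 * real m powr (-2/3) else 0)"
      if "m \<in> shell ` F" for m
    proof -
      have "m > 0" using that by auto
      then have "(real m)\<^sup>2 * real m powr (-8/3) = real m powr (-2/3)"
        using powr_add[of "real m" 2 "-8/3"] by simp
      then show ?thesis by (simp add: \<phi>_def algebra_simps)
    qed
    then show ?thesis using assms(1) by (simp add: sum.If_cases Int_def)
  qed
  also have "\<dots> \<le> (\<Sum>m\<in>{1..nat \<lfloor>\<rho>\<rfloor>}. 72 * real m powr (-2/3))"
    using assms by (intro sum_mono2) (auto simp: le_nat_floor Suc_le_eq)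
  also have "\<dots> \<le> 72 * (3 * real (nat \<lfloor>\<rho>\<rfloor>) powr (1/3))"
    unfolding sum_distrib_left[symmetric] by (intro mult_left_mono sum_powr_le) simp
  also have "\<dots> \<le> 72 * (3 * \<rho> powr (1/3))"
    using assms by (intro mult_left_mono powr_mono2) auto
  finally show ?thesis by simp
qed

text \<open>Here a shell contributes order m^2 times m^(-4), and the tail of the sum of m^(-2) is of
  order 1/\<rho>. The constant is 24 * 4 * 2.\<close>

lemma sum_far_le:
  fixes \<rho> :: real
  assumes "finite F" "\<rho> > 0"
  shows "(\<Sum>x\<in>F. if shell x \<le> \<rho> then 0 else 1 / (bump x)\<^sup>2) \<le> 192 / \<rho>"
proof -
  define \<phi> where "\<phi> m = (if real m \<le> \<rho> then 0 else 4 / real m ^ 4)" for m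
  have "1 / (bump x)\<^sup>2 \<le> 4 / real (shell x) ^ 4" for x
  proof -
    have "((real (shell x))\<^sup>2)\<^sup>2 \<le> (2 * bump x)\<^sup>2" by (intro power_mono shell_sq_le_bump) simp
    then have "(real (shell x))^4 \<le> 4 * (bump x)\<^sup>2" by (simp add: power_mult_distrib)
    moreover have "bump x > 0" "real (shell x) ^ 4 > 0" by simp_all
    ultimately show ?thesis by (auto simp: divide_simps)
  qed
  then have "(\<Sum>x\<in>F. if shell x \<le> \<rho> then 0 else 1 / (bump x)\<^sup>2) \<le> (\<Sum>x\<in>F. \<phi> (shell x))"
    by (intro sum_mono) (auto simp: \<phi>_def)
  also have "\<dots> \<le> (\<Sum>m\<in>shell ` F. 24 * (real m)\<^sup>2 * \<phi> m)"
    by (rule sum_shell_le[OF assms(1)]) (simp add: \<phi>_def)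
  also have "\<dots> = (\<Sum>m\<in>{m\<in>shell ` F. \<not> real m \<le> \<rho>}. 96 * (1 / (real m)\<^sup>2))"
  proof -
    have "24 * (real m)\<^sup>2 * \<phi> m = (if \<not> real m \<le> \<rho> then 96 * (1 / (real m)\<^sup>2) else 0)" for m
      by (simp add: \<phi>_def field_simps eval_nat_numeral)
    then show ?thesis using assms(1) by (simp add: sum.If_cases Int_def)
  qed
  also have "\<dots> \<le> 96 * (2 / \<rho>)"
    unfolding sum_distrib_left[symmetric] using assms
    by (intro mult_left_mono sum_inverse_squares_le) auto
  finally show ?thesis by simp
qed

section \<open>A convolution inequality\<close>

text \<open>
  In the application the kernel is \<open>p\<^sup>3\<close> with \<open>p\<close> of order \<open>|x - z|^(-2/3)\<close>. Splitting it as
  \<open>p\<^sup>2 \<cdot> p\<close> makes both resulting sums \<open>\<Sum> p\<^sup>4\<close>, which are governed by the cutoff radius.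
\<close>

lemma convolution_near_le:
  fixes p :: "'a \<Rightarrow> 'a \<Rightarrow> real" and l h :: "'a \<Rightarrow> real"
  assumes F: "finite F" and l: "\<And>x. l x \<ge> 0"
    and A1: "\<And>x. (\<Sum>z\<in>F. p x z ^ 4) \<le> A" and A2: "\<And>z. (\<Sum>x\<in>F. p x z ^ 4) \<le> A"
  shows "(\<Sum>x\<in>F. l x * (\<Sum>z\<in>F. p x z ^ 3 * h z)\<^sup>2)
    \<le> A * sqrt A * sqrt (\<Sum>x\<in>F. (l x)\<^sup>2) * (\<Sum>z\<in>F. (h z)\<^sup>2)"
proof -
  have A: "A \<ge> 0" using A1[of undefined] sum_nonneg[of F "\<lambda>z. p undefined z ^ 4"] by simp
  have "(\<Sum>x\<in>F. l x * (\<Sum>z\<in>F. p x z ^ 3 * h z)\<^sup>2)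
      \<le> (\<Sum>x\<in>F. l x * (A * (\<Sum>z\<in>F. (p x z)\<^sup>2 * (h z)\<^sup>2)))"
  proof (intro sum_mono mult_left_mono l)
    fix x
    have "(\<Sum>z\<in>F. p x z ^ 3 * h z)\<^sup>2 = (\<Sum>z\<in>F. (p x z)\<^sup>2 * (p x z * h z))\<^sup>2"
      by (simp add: power2_eq_square power3_eq_cube mult.assoc)
    also have "\<dots> \<le> (\<Sum>z\<in>F. ((p x z)\<^sup>2)\<^sup>2) * (\<Sum>z\<in>F. (p x z * h z)\<^sup>2)"
      by (rule Cauchy_Schwarz_ineq_sum)
    also have "\<dots> = (\<Sum>z\<in>F. p x z ^ 4) * (\<Sum>z\<in>F. (p x z)\<^sup>2 * (h z)\<^sup>2)"
      by (simp add: power_mult_distrib)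
    also have "\<dots> \<le> A * (\<Sum>z\<in>F. (p x z)\<^sup>2 * (h z)\<^sup>2)"
      by (intro mult_right_mono A1 sum_nonneg) simp
    finally show "(\<Sum>z\<in>F. p x z ^ 3 * h z)\<^sup>2 \<le> A * (\<Sum>z\<in>F. (p x z)\<^sup>2 * (h z)\<^sup>2)" .
  qed
  also have "\<dots> = A * (\<Sum>z\<in>F. (h z)\<^sup>2 * (\<Sum>x\<in>F. l x * (p x z)\<^sup>2))"
    unfolding sum_distrib_left by (subst sum.swap) (simp add: algebra_simps)
  \<comment> \<open>After the exchange of sums the remaining factor \<open>(p x z)\<^sup>2\<close>
    is paired with \<open>l\<close> in the variable \<open>x\<close>, by a second use of
    Cauchy-Schwarz.\<close>
  also have "\<dots> \<le> A * (\<Sum>z\<in>F. (h z)\<^sup>2 * (sqrt (\<Sum>x\<in>F. (l x)\<^sup>2) * sqrt A))"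
  proof (intro mult_left_mono sum_mono A)
    fix z
    have "(\<Sum>x\<in>F. l x * (p x z)\<^sup>2) \<le> sqrt ((\<Sum>x\<in>F. l x * (p x z)\<^sup>2)\<^sup>2)" by simp
    also have "\<dots> \<le> sqrt ((\<Sum>x\<in>F. (l x)\<^sup>2) * (\<Sum>x\<in>F. ((p x z)\<^sup>2)\<^sup>2))"
      by (intro real_sqrt_le_mono Cauchy_Schwarz_ineq_sum)
    also have "\<dots> = sqrt (\<Sum>x\<in>F. (l x)\<^sup>2) * sqrt (\<Sum>x\<in>F. p x z ^ 4)"
      by (simp add: real_sqrt_mult)
    also have "\<dots> \<le> sqrt (\<Sum>x\<in>F. (l x)\<^sup>2) * sqrt A"
      using A2 by (intro mult_left_mono real_sqrt_le_mono) (auto intro: sum_nonneg)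
    finally show "(\<Sum>x\<in>F. l x * (p x z)\<^sup>2) \<le> sqrt (\<Sum>x\<in>F. (l x)\<^sup>2) * sqrt A" .
  qed auto
  also have "\<dots> = A * sqrt A * sqrt (\<Sum>x\<in>F. (l x)\<^sup>2) * (\<Sum>z\<in>F. (h z)\<^sup>2)"
    unfolding sum_distrib_right[symmetric] by (simp only: mult_ac)
  finally show ?thesis .
qed

text \<open>Cauchy-Schwarz with weight \<open>h\<close> brings out the l1 norm of \<open>h\<close>.
  The double sum that remains pairs \<open>l x * k x z\<close> with \<open>k x z * h z\<close> on
  \<open>F \<times> F\<close>, where Cauchy-Schwarz applies again.\<close>

lemma convolution_far_le:
  fixes k :: "'a \<Rightarrow> 'a \<Rightarrow> real" and l h :: "'a \<Rightarrow> real"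
  assumes F: "finite F" and l: "\<And>x. l x \<ge> 0" and h: "\<And>x. h x \<ge> 0"
    and A1: "\<And>x. (\<Sum>z\<in>F. (k x z)\<^sup>2) \<le> A" and A2: "\<And>z. (\<Sum>x\<in>F. (k x z)\<^sup>2) \<le> A"
  shows "(\<Sum>x\<in>F. l x * (\<Sum>z\<in>F. k x z * h z)\<^sup>2)
    \<le> A * (\<Sum>z\<in>F. h z) * sqrt (\<Sum>x\<in>F. (l x)\<^sup>2) * sqrt (\<Sum>z\<in>F. (h z)\<^sup>2)"
proof -
  have A: "A \<ge> 0" using A1[of undefined] sum_nonneg[of F "\<lambda>z. (k undefined z)\<^sup>2"] by simp
  have "(\<Sum>x\<in>F. l x * (\<Sum>z\<in>F. k x z * h z)\<^sup>2)
      \<le> (\<Sum>x\<in>F. l x * ((\<Sum>z\<in>F. h z) * (\<Sum>z\<in>F. (k x z)\<^sup>2 * h z)))"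
  proof (intro sum_mono mult_left_mono l)
    fix x
    have "(\<Sum>z\<in>F. k x z * h z)\<^sup>2 = (\<Sum>z\<in>F. sqrt (h z) * (k x z * sqrt (h z)))\<^sup>2"
    proof -
      have "k x z * h z = sqrt (h z) * (k x z * sqrt (h z))" for z
        using real_sqrt_mult_self[of "h z"] h[of z] by (simp add: mult.left_commute)
      then show ?thesis by (simp only:)
    qed
    also have "\<dots> \<le> (\<Sum>z\<in>F. (sqrt (h z))\<^sup>2) * (\<Sum>z\<in>F. (k x z * sqrt (h z))\<^sup>2)"
      by (rule Cauchy_Schwarz_ineq_sum)
    also have "\<dots> = (\<Sum>z\<in>F. h z) * (\<Sum>z\<in>F. (k x z)\<^sup>2 * h z)"
      using h by (simp add: power_mult_distrib)
    finally show "(\<Sum>z\<in>F. k x z * h z)\<^sup>2 \<le> (\<Sum>z\<in>F. h z) * (\<Sum>z\<in>F. (k x z)\<^sup>2 * h z)" .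
  qed
  also have "\<dots> = (\<Sum>z\<in>F. h z) * (\<Sum>q\<in>F \<times> F. (l (fst q) * k (fst q) (snd q)) * (k (fst q) (snd q) * h (snd q)))"
    by (simp add: sum.cartesian_product' sum_distrib_left power2_eq_square mult_ac)
  also have "\<dots> \<le> (\<Sum>z\<in>F. h z) * (sqrt (A * (\<Sum>x\<in>F. (l x)\<^sup>2)) * sqrt (A * (\<Sum>z\<in>F. (h z)\<^sup>2)))"
  proof (rule mult_left_mono)
    let ?f = "\<lambda>q. l (fst q) * k (fst q) (snd q)" and ?g = "\<lambda>q. k (fst q) (snd q) * h (snd q)"
    have "(\<Sum>q\<in>F \<times> F. (?f q)\<^sup>2) = (\<Sum>x\<in>F. (l x)\<^sup>2 * (\<Sum>z\<in>F. (k x z)\<^sup>2))"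
      by (simp add: sum.cartesian_product' sum_distrib_left power_mult_distrib)
    also have "\<dots> \<le> (\<Sum>x\<in>F. (l x)\<^sup>2 * A)" by (intro sum_mono mult_left_mono A1) simp
    finally have f: "(\<Sum>q\<in>F \<times> F. (?f q)\<^sup>2) \<le> A * (\<Sum>x\<in>F. (l x)\<^sup>2)"
      by (simp add: sum_distrib_left mult.commute)
    have "(\<Sum>q\<in>F \<times> F. (?g q)\<^sup>2) = (\<Sum>z\<in>F. (h z)\<^sup>2 * (\<Sum>x\<in>F. (k x z)\<^sup>2))"
      by (simp add: sum.cartesian_product' sum_distrib_left power_mult_distrib mult.commute)
        (subst sum.swap, simp)
    also have "\<dots> \<le> (\<Sum>z\<in>F. (h z)\<^sup>2 * A)" by (intro sum_mono mult_left_mono A2) simp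
    finally have g: "(\<Sum>q\<in>F \<times> F. (?g q)\<^sup>2) \<le> A * (\<Sum>z\<in>F. (h z)\<^sup>2)"
      by (simp add: sum_distrib_left mult.commute)
    have "(\<Sum>q\<in>F \<times> F. ?f q * ?g q) \<le> sqrt ((\<Sum>q\<in>F \<times> F. ?f q * ?g q)\<^sup>2)" by simp
    also have "\<dots> \<le> sqrt ((\<Sum>q\<in>F \<times> F. (?f q)\<^sup>2) * (\<Sum>q\<in>F \<times> F. (?g q)\<^sup>2))"
      by (intro real_sqrt_le_mono Cauchy_Schwarz_ineq_sum)
    also have "\<dots> \<le> sqrt ((A * (\<Sum>x\<in>F. (l x)\<^sup>2)) * (A * (\<Sum>z\<in>F. (h z)\<^sup>2)))"
      using A by (intro real_sqrt_le_mono mult_mono f g mult_nonneg_nonneg sum_nonneg) auto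
    finally show "(\<Sum>q\<in>F \<times> F. ?f q * ?g q) \<le> sqrt (A * (\<Sum>x\<in>F. (l x)\<^sup>2)) * sqrt (A * (\<Sum>z\<in>F. (h z)\<^sup>2))"
      by (simp add: real_sqrt_mult)
  qed (simp add: h sum_nonneg)
  also have "\<dots> = A * (\<Sum>z\<in>F. h z) * sqrt (\<Sum>x\<in>F. (l x)\<^sup>2) * sqrt (\<Sum>z\<in>F. (h z)\<^sup>2)"
    using A by (simp add: real_sqrt_mult mult_ac)
  finally show ?thesis .
qed

text \<open>Near and far parts of the kernel are estimated separately. The radius stays free,
  because its best choice depends on the relative size of the norms of \<open>l\<close> and
  \<open>h\<close>.\<close>

lemma convolution_le:
  fixes l h :: "int ^ 3 \<Rightarrow> real"
  assumes F: "finite F" and l: "\<And>x. l x \<ge> 0" and h: "\<And>x. h x \<ge> 0" and \<rho>: "\<rho> > 0"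
  shows "(\<Sum>x\<in>F. l x * (\<Sum>z\<in>F. h z / bump (x - z))\<^sup>2)
    \<le> 6400 * sqrt (\<Sum>x\<in>F. (l x)\<^sup>2) * sqrt (\<Sum>z\<in>F. (h z)\<^sup>2) *
      (sqrt \<rho> * sqrt (\<Sum>z\<in>F. (h z)\<^sup>2) + (\<Sum>z\<in>F. h z) / \<rho>)"
proof -
  \<comment> \<open>A cube root of the near kernel: \<open>p x z ^ 3\<close> is the kernel itself
    and \<open>p x z ^ 4\<close> is what \<open>sum_near_le\<close> bounds.\<close>
  define p where "p x z = (if shell (x - z) \<le> \<rho> then bump (x - z) powr (-1/3) else 0)" for x z
  define k where "k x z = (if shell (x - z) \<le> \<rho> then 0 else 1 / bump (x - z))" for x z
  have pw: "(b powr (-1/3)) ^ 3 = 1 / b" "(b powr (-1/3)) ^ 4 = b powr (-4/3)" if "b > 0" for b :: real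
    using that powr_power[of b "-1/3" 3] powr_power[of b "-1/3" 4] by (simp_all add: powr_minus_divide)
  have K: "h z / bump (x - z) = p x z ^ 3 * h z + k x z * h z" for x z
    unfolding p_def k_def using pw(1)[OF bump_pos[of "x - z"]] by (simp only: split: if_split) simp
  have inj: "inj_on (\<lambda>z. x - z) F" "inj_on (\<lambda>x. x - z) F" for x z :: "int ^ 3"
    by (auto simp: inj_on_def)
  have p4: "p x z ^ 4 = (if shell (x - z) \<le> \<rho> then bump (x - z) powr (-4/3) else 0)" for x z
    unfolding p_def using pw(2)[OF bump_pos[of "x - z"]] by simp
  have k2: "(k x z)\<^sup>2 = (if shell (x - z) \<le> \<rho> then 0 else 1 / (bump (x - z))\<^sup>2)" for x z
    by (simp add: k_def power_divide)
  have P: "(\<Sum>z\<in>F. p x z ^ 4) \<le> 216 * \<rho> powr (1/3)" "(\<Sum>x\<in>F. p x z ^ 4) \<le> 216 * \<rho> powr (1/3)" for x z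
    using sum_near_le[of "(\<lambda>z. x - z) ` F" \<rho>] sum_near_le[of "(\<lambda>x. x - z) ` F" \<rho>] F \<rho>
    by (simp_all add: sum.reindex[OF inj(1)] sum.reindex[OF inj(2)] p4)
  have Q: "(\<Sum>z\<in>F. (k x z)\<^sup>2) \<le> 192 / \<rho>" "(\<Sum>x\<in>F. (k x z)\<^sup>2) \<le> 192 / \<rho>" for x z
    using sum_far_le[of "(\<lambda>z. x - z) ` F" \<rho>] sum_far_le[of "(\<lambda>x. x - z) ` F" \<rho>] F \<rho>
    by (simp_all add: sum.reindex[OF inj(1)] sum.reindex[OF inj(2)] k2)
  define a b c where "a = sqrt (\<Sum>x\<in>F. (l x)\<^sup>2)" and "b = sqrt (\<Sum>z\<in>F. (h z)\<^sup>2)" and "c = (\<Sum>z\<in>F. h z)"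
  have abc: "a \<ge> 0" "b \<ge> 0" "c \<ge> 0" by (auto simp: a_def b_def c_def h sum_nonneg)
  have b2: "(\<Sum>z\<in>F. (h z)\<^sup>2) = b\<^sup>2" by (simp add: b_def sum_nonneg)
  have "(\<Sum>x\<in>F. l x * (\<Sum>z\<in>F. h z / bump (x - z))\<^sup>2)
      \<le> (\<Sum>x\<in>F. l x * (2 * (\<Sum>z\<in>F. p x z ^ 3 * h z)\<^sup>2 + 2 * (\<Sum>z\<in>F. k x z * h z)\<^sup>2))"
  proof (intro sum_mono mult_left_mono l)
    fix x
    have "(u + v)\<^sup>2 \<le> 2 * u\<^sup>2 + 2 * v\<^sup>2" for u v :: real
      using zero_le_power2[of "u - v"] by (simp add: power2_eq_square algebra_simps)
    then show "(\<Sum>z\<in>F. h z / bump (x - z))\<^sup>2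
        \<le> 2 * (\<Sum>z\<in>F. p x z ^ 3 * h z)\<^sup>2 + 2 * (\<Sum>z\<in>F. k x z * h z)\<^sup>2"
      by (simp add: K sum.distrib)
  qed
  also have "\<dots> = 2 * (\<Sum>x\<in>F. l x * (\<Sum>z\<in>F. p x z ^ 3 * h z)\<^sup>2) + 2 * (\<Sum>x\<in>F. l x * (\<Sum>z\<in>F. k x z * h z)\<^sup>2)"
    by (simp add: sum.distrib sum_distrib_left algebra_simps)
  also have "\<dots> \<le> 2 * ((216 * \<rho> powr (1/3)) * sqrt (216 * \<rho> powr (1/3)) * a * b\<^sup>2) + 2 * (192 / \<rho> * c * a * b)"
  proof (intro add_mono mult_left_mono)
    show "(\<Sum>x\<in>F. l x * (\<Sum>z\<in>F. p x z ^ 3 * h z)\<^sup>2) \<le> (216 * \<rho> powr (1/3)) * sqrt (216 * \<rho> powr (1/3)) * a * b\<^sup>2"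
      using convolution_near_le[where l = l and h = h, OF F l P] unfolding a_def[symmetric] b2 .
    show "(\<Sum>x\<in>F. l x * (\<Sum>z\<in>F. k x z * h z)\<^sup>2) \<le> 192 / \<rho> * c * a * b"
      using convolution_far_le[where l = l and h = h, OF F l h Q] unfolding a_def b_def c_def .
  qed simp_all
  also have "(216 * \<rho> powr (1/3)) * sqrt (216 * \<rho> powr (1/3)) = 216 * sqrt 216 * sqrt \<rho>"
    using \<rho> by (simp add: real_sqrt_mult powr_half_sqrt[symmetric] powr_powr powr_add[symmetric])
  also have "2 * (216 * sqrt 216 * sqrt \<rho> * a * b\<^sup>2) + 2 * (192 / \<rho> * c * a * b)
      \<le> 6400 * sqrt \<rho> * a * b\<^sup>2 + 6400 / \<rho> * c * a * b"
  proof -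
    \<comment> \<open>The constant 6400 is 432 times the root of 216, rounded up; the far constant
      384 is smaller.\<close>
    have "sqrt 216 \<le> sqrt ((148/10)\<^sup>2)" by (intro real_sqrt_le_mono) (simp add: power2_eq_square)
    then have "sqrt 216 \<le> 148/10" by (simp only: real_sqrt_abs)
    then have s: "432 * sqrt 216 \<le> 6400" by simp
    define u w where "u = sqrt \<rho> * a * b\<^sup>2" and "w = c * a * b / \<rho>"
    have "u \<ge> 0" "w \<ge> 0" using abc \<rho> by (simp_all add: u_def w_def)
    then have "432 * sqrt 216 * u + 384 * w \<le> 6400 * u + 6400 * w"
      using s by (intro add_mono mult_right_mono) simp_all
    moreover have "2 * (216 * sqrt 216 * sqrt \<rho> * a * b\<^sup>2) + 2 * (192 / \<rho> * c * a * b)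
        = 432 * sqrt 216 * u + 384 * w" by (simp add: u_def w_def)
    moreover have "6400 * sqrt \<rho> * a * b\<^sup>2 + 6400 / \<rho> * c * a * b = 6400 * u + 6400 * w"
      by (simp add: u_def w_def)
    ultimately show ?thesis by simp
  qed
  also have "\<dots> = 6400 * a * b * (sqrt \<rho> * b + c / \<rho>)"
    by (simp add: algebra_simps power2_eq_square)
  finally show ?thesis by (simp add: a_def b_def c_def)
qed

section \<open>The martingale of the excess local time\<close>

lemma local_time_Suc: "local_time S (Suc n) x = local_time S n x + of_bool (S (Suc n) = x)"
  by (simp add: local_time_def)

lemma local_time_cong: "(\<And>k. k \<le> n \<Longrightarrow> S k = S' k) \<Longrightarrow> local_time S n = local_time S' n"
  by (intro ext) (simp add: local_time_def)

lemma local_time_mono: "m \<le> n \<Longrightarrow> local_time S m x \<le> local_time S n x"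
  unfolding local_time_def by (intro sum_mono2) auto

lemma local_time_eq_0_iff: "local_time S n x = 0 \<longleftrightarrow> x \<notin> S ` {..n}"
  by (auto simp: local_time_def)

lemma sum_local_time_mult:
  fixes f :: "'a \<Rightarrow> real"
  assumes "finite F" "S ` {..n} \<subseteq> F"
  shows "(\<Sum>x\<in>F. real (local_time S n x) * f x) = (\<Sum>k\<le>n. f (S k))"
proof -
  have "(\<Sum>x\<in>F. real (local_time S n x) * f x) = (\<Sum>x\<in>F. \<Sum>k\<le>n. if S k = x then f x else 0)"
    unfolding local_time_def of_nat_sum sum_distrib_right by (intro sum.cong refl) auto
  also have "\<dots> = (\<Sum>k\<le>n. \<Sum>x\<in>F. if S k = x then f x else 0)" by (rule sum.swap)
  also have "\<dots> = (\<Sum>k\<le>n. f (S k))"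
    using assms by (intro sum.cong) (auto simp: sum.delta)
  finally show ?thesis .
qed

lemma sum_local_time:
  assumes "finite F" "S ` {..n} \<subseteq> F"
  shows "(\<Sum>x\<in>F. real (local_time S n x)) = real n + 1"
  using sum_local_time_mult[OF assms, of "\<lambda>_. 1"] by simp

text \<open>Truncated subtraction of natural numbers supplies the positive part.\<close>

definition excess :: "nat \<Rightarrow> (nat \<Rightarrow> 'a) \<Rightarrow> nat \<Rightarrow> 'a \<Rightarrow> real" where
  "excess L S n x = real (local_time S n x - L)"

lemma excess_nonneg [simp]: "excess L S n x \<ge> 0"
  by (simp add: excess_def)

lemma excess_le: "excess L S n x \<le> real (local_time S n x)"
  by (simp add: excess_def)

lemma excess_0 [simp]: "excess 0 S n x = real (local_time S n x)"
  by (simp add: excess_def)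

lemma excess_mono: "m \<le> n \<Longrightarrow> excess L S m x \<le> excess L S n x"
  unfolding excess_def using local_time_mono[of m n S x] by simp

lemma excess_eq_0: "x \<notin> S ` {..n} \<Longrightarrow> excess L S n x = 0"
  using local_time_eq_0_iff[of S n x] by (simp add: excess_def)

lemma excess_cong: "(\<And>k. k \<le> n \<Longrightarrow> S k = S' k) \<Longrightarrow> excess L S n = excess L S' n"
  using local_time_cong[of n S S'] by (simp add: excess_def fun_eq_iff)

section \<open>The potential of the excess and its martingale part\<close>

definition potential :: "nat \<Rightarrow> (nat \<Rightarrow> int ^ 3) \<Rightarrow> nat \<Rightarrow> int ^ 3 \<Rightarrow> real" where
  "potential L S n x = (\<Sum>z\<in>S ` {..n}. excess L S n z * green (x - z))"

text \<open>At \<open>x = S n\<close> this is the conditional expectation of the potential at the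
  next position, with the local times frozen at time \<open>n\<close>.\<close>

definition mean_potential :: "nat \<Rightarrow> (nat \<Rightarrow> int ^ 3) \<Rightarrow> nat \<Rightarrow> int ^ 3 \<Rightarrow> real" where
  "mean_potential L S n x = measure_pmf.expectation srw_step (\<lambda>s. potential L S n (x + s))"

text \<open>Both terms of an increment use the local times of time \<open>k\<close>, so only the
  movement of the walker enters; the growth of the local time is accounted for in
  \<open>sum_excess_sq_le\<close>.\<close>

definition mart :: "nat \<Rightarrow> (nat \<Rightarrow> int ^ 3) \<Rightarrow> nat \<Rightarrow> real" where
  "mart L S n = (\<Sum>k<n. potential L S k (S (Suc k)) - mean_potential L S k (S k))"

text \<open>A bound, known at time \<open>n\<close>, for the next martingale increment. The factor
  is twice the 12000 of \<open>green_gradient\<close>: once for the new value and once for its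
  mean.\<close>

definition slope :: "nat \<Rightarrow> (nat \<Rightarrow> int ^ 3) \<Rightarrow> nat \<Rightarrow> real" where
  "slope L S n = 24000 * (\<Sum>z\<in>S ` {..n}. excess L S n z / bump (S n - z))"

text \<open>Squared increment bounds instead of conditional variances; the sum depends only on
  positions before time \<open>n\<close>, as the exponential compensation requires.\<close>

definition quadvar :: "nat \<Rightarrow> (nat \<Rightarrow> int ^ 3) \<Rightarrow> nat \<Rightarrow> real" where
  "quadvar L S n = (\<Sum>k<n. (slope L S k)\<^sup>2)"

lemma sum_excess_superset:
  fixes f :: "'a \<Rightarrow> real \<Rightarrow> real"
  assumes "finite F" "S ` {..n} \<subseteq> F" "\<And>x. f x 0 = 0"
  shows "(\<Sum>z\<in>F. f z (excess L S n z)) = (\<Sum>z\<in>S ` {..n}. f z (excess L S n z))"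
  using assms by (intro sum.mono_neutral_right) (auto simp: excess_eq_0)

lemma image_cong_prefix: "(\<And>k. k \<le> n \<Longrightarrow> S k = S' k) \<Longrightarrow> S ` {..n} = S' ` {..n}"
  by (rule image_cong) auto

lemma potential_cong: "(\<And>k. k \<le> n \<Longrightarrow> S k = S' k) \<Longrightarrow> potential L S n = potential L S' n"
  unfolding potential_def using excess_cong[of n S S' L] image_cong_prefix[of n S S'] by simp

lemma mean_potential_cong: "(\<And>k. k \<le> n \<Longrightarrow> S k = S' k) \<Longrightarrow> mean_potential L S n = mean_potential L S' n"
  unfolding mean_potential_def using potential_cong[of n S S' L] by simp

lemma slope_cong: "(\<And>k. k \<le> n \<Longrightarrow> S k = S' k) \<Longrightarrow> slope L S n = slope L S' n"
  unfolding slope_def using excess_cong[of n S S' L] image_cong_prefix[of n S S'] by simp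

lemma mart_cong:
  assumes "\<And>k. k \<le> n \<Longrightarrow> S k = S' k"
  shows "mart L S n = mart L S' n"
  unfolding mart_def
proof (rule sum.cong)
  fix k assume k: "k \<in> {..<n}"
  have "potential L S k = potential L S' k" "mean_potential L S k = mean_potential L S' k"
    by (rule potential_cong mean_potential_cong, rule assms, use k in simp)+
  moreover have "S k = S' k" "S (Suc k) = S' (Suc k)" using assms k by auto
  ultimately show "potential L S k (S (Suc k)) - mean_potential L S k (S k) =
      potential L S' k (S' (Suc k)) - mean_potential L S' k (S' k)" by simp
qed simp

lemma quadvar_cong:
  assumes "\<And>k. k < n \<Longrightarrow> S k = S' k"
  shows "quadvar L S n = quadvar L S' n"
  unfolding quadvar_def
proof (rule sum.cong)
  fix k assume k: "k \<in> {..<n}"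
  have "slope L S k = slope L S' k" by (rule slope_cong, rule assms, use k in simp)
  then show "(slope L S k)\<^sup>2 = (slope L S' k)\<^sup>2" by simp
qed simp

lemma integrable_srw_step [simp]: "integrable (measure_pmf srw_step) (f :: int ^ 'd::finite \<Rightarrow> real)"
  by (rule integrable_measure_pmf_finite) (simp add: set_pmf_srw_step)

text \<open>Every translate of the kernel is superharmonic, and the one centred at the current site
  drops by at least 1.\<close>

lemma mean_potential_le:
  "mean_potential L S n (S n) \<le> potential L S n (S n) - excess L S n (S n)"
proof -
  have "mean_potential L S n (S n) =
      (\<Sum>z\<in>S ` {..n}. excess L S n z * measure_pmf.expectation srw_step (\<lambda>s. green (S n - z + s)))"
    unfolding mean_potential_def potential_def
    by (simp add: Bochner_Integration.integral_sum algebra_simps)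
  also have "\<dots> \<le> (\<Sum>z\<in>S ` {..n}. excess L S n z * (green (S n - z) - of_bool (S n - z = 0)))"
    by (intro sum_mono mult_left_mono green_superharmonic) simp
  also have "\<dots> = potential L S n (S n) - (\<Sum>z\<in>S ` {..n}. excess L S n z * of_bool (S n - z = 0))"
    by (simp add: potential_def algebra_simps sum_subtractf)
  also have "(\<Sum>z\<in>S ` {..n}. excess L S n z * of_bool (S n - z = 0)) = excess L S n (S n)"
  proof -
    have "excess L S n z * of_bool (S n - z = 0) = (if z = S n then excess L S n z else 0)" for z
      by auto
    then show ?thesis by (simp add: sum.delta)
  qed
  finally show ?thesis .
qed

lemma potential_increment_le:
  assumes "s \<in> set_pmf srw_step"
  shows "\<bar>potential L S n (S n + s) - potential L S n (S n)\<bar> \<le> slope L S n / 2"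
proof -
  have "\<bar>potential L S n (S n + s) - potential L S n (S n)\<bar>
      = \<bar>\<Sum>z\<in>S ` {..n}. excess L S n z * (green (S n - z + s) - green (S n - z))\<bar>"
    by (simp add: potential_def sum_subtractf algebra_simps)
  also have "\<dots> \<le> (\<Sum>z\<in>S ` {..n}. \<bar>excess L S n z * (green (S n - z + s) - green (S n - z))\<bar>)"
    by (rule sum_abs)
  also have "\<dots> \<le> (\<Sum>z\<in>S ` {..n}. excess L S n z * (12000 / bump (S n - z)))"
    unfolding abs_mult by (intro sum_mono mult_mono green_gradient[OF assms]) auto
  also have "\<dots> = slope L S n / 2"
    by (simp add: slope_def sum_distrib_left sum_divide_distrib algebra_simps)
  finally show ?thesis .
qed

text \<open>The potential after the step and its mean both lie within half the slope of the current
  potential.\<close>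

lemma mart_increment_le:
  assumes "s \<in> set_pmf srw_step"
  shows "\<bar>potential L S n (S n + s) - mean_potential L S n (S n)\<bar> \<le> slope L S n"
proof -
  let ?E = "measure_pmf.expectation (srw_step :: (int ^ 3) pmf)"
  have "mean_potential L S n (S n) - potential L S n (S n)
      = ?E (\<lambda>s. potential L S n (S n + s) - potential L S n (S n))"
    unfolding mean_potential_def by simp
  also have "\<bar>\<dots>\<bar> \<le> ?E (\<lambda>s. \<bar>potential L S n (S n + s) - potential L S n (S n)\<bar>)"
    by (rule integral_abs_bound)
  also have "\<dots> \<le> ?E (\<lambda>s. slope L S n / 2)"
  proof (rule integral_mono_AE[OF integrable_srw_step integrable_srw_step], rule AE_pmfI)
    fix s :: "int ^ 3" assume "s \<in> set_pmf srw_step"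
    then show "\<bar>potential L S n (S n + s) - potential L S n (S n)\<bar> \<le> slope L S n / 2"
      by (rule potential_increment_le)
  qed
  also have "\<dots> = slope L S n / 2" by simp
  finally show ?thesis using potential_increment_le[OF assms, of L S n] by linarith
qed

section \<open>The exponential supermartingale and its tail bound\<close>

lemma slope_nonneg: "slope L S n \<ge> 0"
  unfolding slope_def
  by (intro mult_nonneg_nonneg sum_nonneg divide_nonneg_nonneg) (auto intro: less_imp_le)

text \<open>Hoeffding's lemma for a centred variable on an interval of length twice the slope,
  conditionally on the path up to time \<open>n\<close>.\<close>

lemma hoeffding_step:
  assumes "t > 0"
  shows "(\<integral>\<^sup>+s. ennreal (exp (t * (potential L S n (S n + s) - mean_potential L S n (S n)))) \<partial>measure_pmf srw_step)
    \<le> ennreal (exp (t\<^sup>2 * (slope L S n)\<^sup>2 / 2))"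
proof -
  let ?f = "\<lambda>s. potential L S n (S n + s) - mean_potential L S n (S n)"
  have "measure_pmf.expectation srw_step ?f =
      measure_pmf.expectation srw_step (\<lambda>s. potential L S n (S n + s)) - mean_potential L S n (S n)"
    by simp
  then have E0: "measure_pmf.expectation srw_step ?f = 0" by (simp only: mean_potential_def)
  interpret interval_bounded_random_variable "measure_pmf srw_step" ?f "- slope L S n" "slope L S n"
  proof
    show "AE s in measure_pmf srw_step. ?f s \<in> {- slope L S n..slope L S n}"
    proof (rule AE_pmfI)
      fix s :: "int ^ 3" assume "s \<in> set_pmf srw_step"
      from mart_increment_le[OF this, of L S n]
      have "- slope L S n \<le> ?f s" "?f s \<le> slope L S n" by linarith+
      then show "?f s \<in> {- slope L S n..slope L S n}" by simp
    qed
  qed simp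
  have "t\<^sup>2 * (slope L S n - - slope L S n)\<^sup>2 / 8 = t\<^sup>2 * (slope L S n)\<^sup>2 / 2"
    by (simp add: power_mult_distrib)
  with Hoeffdings_lemma_nn_integral_0[OF assms E0] show ?thesis by (simp only:)
qed

text \<open>The compensated exponential is a supermartingale: the new summand of
  \<open>quadvar\<close> is fixed before the step is drawn and cancels the Hoeffding bound.\<close>

lemma nn_integral_exp_mart_le:
  assumes "t > 0"
  shows "(\<integral>\<^sup>+S. ennreal (exp (t * mart L S n - t\<^sup>2 / 2 * quadvar L S n)) \<partial>srw 0) \<le> 1"
proof (induction n)
  case 0
  interpret prob_space "srw (0 :: int ^ 3)" by (rule prob_space_srw)
  show ?case using emeasure_space_1 by (simp add: mart_def quadvar_def)
next
  case (Suc n)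
  let ?Z = "\<lambda>n S. exp (t * mart L S n - t\<^sup>2 / 2 * quadvar L S n)"
  have ad: "adapted (Suc n) (\<lambda>S. ennreal (?Z (Suc n) S))"
  proof (rule adaptedI)
    fix S S' :: "nat \<Rightarrow> int ^ 3" assume e: "\<And>k. k \<le> Suc n \<Longrightarrow> S k = S' k"
    have "mart L S (Suc n) = mart L S' (Suc n)" "quadvar L S (Suc n) = quadvar L S' (Suc n)"
      by (rule mart_cong quadvar_cong, rule e, simp)+
    then show "ennreal (?Z (Suc n) S) = ennreal (?Z (Suc n) S')" by simp
  qed
  have step: "?Z (Suc n) (S(Suc n := S n + s)) =
      ?Z n S * exp (- (t\<^sup>2 * (slope L S n)\<^sup>2 / 2)) * exp (t * (potential L S n (S n + s) - mean_potential L S n (S n)))"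
    for S s
  proof -
    let ?S = "S(Suc n := S n + s)"
    have e: "mart L ?S n = mart L S n" "quadvar L ?S n = quadvar L S n" "potential L ?S n = potential L S n"
      "mean_potential L ?S n = mean_potential L S n" "slope L ?S n = slope L S n"
      by (rule mart_cong quadvar_cong potential_cong mean_potential_cong slope_cong, simp)+
    have "mart L ?S (Suc n) = mart L S n + (potential L S n (S n + s) - mean_potential L S n (S n))"
      using e(1) by (simp add: mart_def e(3,4))
    moreover have "quadvar L ?S (Suc n) = quadvar L S n + (slope L S n)\<^sup>2"
      using e(2) by (simp add: quadvar_def e(5))
    ultimately show ?thesis by (simp only: exp_add[symmetric]) (simp add: algebra_simps)
  qed
  have "(\<integral>\<^sup>+S. ennreal (?Z (Suc n) S) \<partial>srw 0) =
      (\<integral>\<^sup>+S. (\<integral>\<^sup>+s. ennreal (?Z (Suc n) (S(Suc n := S n + s))) \<partial>measure_pmf srw_step) \<partial>srw 0)"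
    by (rule nn_integral_srw_Suc[OF ad])
  also have "\<dots> \<le> (\<integral>\<^sup>+S. ennreal (?Z n S) \<partial>srw 0)"
  proof (rule nn_integral_mono)
    fix S :: "nat \<Rightarrow> int ^ 3"
    let ?c = "?Z n S * exp (- (t\<^sup>2 * (slope L S n)\<^sup>2 / 2))"
    have "(\<integral>\<^sup>+s. ennreal (?Z (Suc n) (S(Suc n := S n + s))) \<partial>measure_pmf srw_step) =
        ennreal ?c * (\<integral>\<^sup>+s. ennreal (exp (t * (potential L S n (S n + s) - mean_potential L S n (S n)))) \<partial>measure_pmf srw_step)"
      unfolding step by (subst nn_integral_cmult[symmetric]) (simp_all add: ennreal_mult)
    also have "\<dots> \<le> ennreal ?c * ennreal (exp (t\<^sup>2 * (slope L S n)\<^sup>2 / 2))"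
      by (intro mult_left_mono hoeffding_step[OF assms]) simp
    also have "\<dots> = ennreal (?Z n S)"
      by (simp add: ennreal_mult[symmetric] exp_add[symmetric])
    finally show "(\<integral>\<^sup>+s. ennreal (?Z (Suc n) (S(Suc n := S n + s))) \<partial>measure_pmf srw_step) \<le> ennreal (?Z n S)" .
  qed
  also have "\<dots> \<le> 1" by (rule Suc.IH)
  finally show ?case .
qed

text \<open>Markov's inequality for the compensated exponential, which is bounded below on the
  event.\<close>

lemma mart_tail:
  assumes "a > 0" "v > 0"
  shows "measure (srw 0) {S. a \<le> mart L S n \<and> quadvar L S n \<le> v} \<le> exp (- (a\<^sup>2 / (2 * v)))"
proof -
  interpret prob_space "srw (0 :: int ^ 3)" by (rule prob_space_srw)
  \<comment> \<open>This value maximises \<open>t * a - t\<^sup>2 / 2 * v\<close>.\<close>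
  define t where "t = a / v"
  have l: "t > 0" using assms by (simp add: t_def)
  let ?Z = "\<lambda>S. exp (t * mart L S n - t\<^sup>2 / 2 * quadvar L S n)"
  let ?A = "{S. a \<le> mart L S n \<and> quadvar L S n \<le> v}"
  have c: "mart L S n = mart L S' n \<and> quadvar L S n = quadvar L S' n"
    if "\<And>k. k \<le> n \<Longrightarrow> S k = S' k" for S S'
    using mart_cong[of n S S' L] quadvar_cong[of n S S' L] that by simp
  have A: "?A \<in> events"
  proof (rule sets_adapted_srw[of n], rule adaptedI)
    fix S S' :: "nat \<Rightarrow> int ^ 3" assume "\<And>k. k \<le> n \<Longrightarrow> S k = S' k"
    from c[OF this] show "(a \<le> mart L S n \<and> quadvar L S n \<le> v) = (a \<le> mart L S' n \<and> quadvar L S' n \<le> v)" by simp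
  qed
  have Zm: "(\<lambda>S. ennreal (?Z S)) \<in> borel_measurable (srw 0)"
  proof (rule measurable_adapted_srw[of n], rule adaptedI)
    fix S S' :: "nat \<Rightarrow> int ^ 3" assume "\<And>k. k \<le> n \<Longrightarrow> S k = S' k"
    from c[OF this] show "ennreal (?Z S) = ennreal (?Z S')" by simp
  qed
  have e: "exp (a\<^sup>2 / (2 * v)) \<le> ?Z S" if "S \<in> ?A" for S
  proof -
    have "a\<^sup>2 / (2 * v) = t * a - t\<^sup>2 / 2 * v"
      using assms by (simp add: t_def power2_eq_square field_simps)
    also have "\<dots> \<le> t * mart L S n - t\<^sup>2 / 2 * quadvar L S n"
      using that l by (intro diff_mono mult_left_mono) auto
    finally show ?thesis by simp
  qed
  have "ennreal (exp (a\<^sup>2 / (2 * v))) * emeasure (srw 0) ?A = (\<integral>\<^sup>+S. ennreal (exp (a\<^sup>2 / (2 * v))) * indicator ?A S \<partial>srw 0)"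
    using A by (simp add: nn_integral_cmult_indicator)
  also have "\<dots> \<le> (\<integral>\<^sup>+S. ennreal (?Z S) \<partial>srw 0)"
    by (intro nn_integral_mono) (use e in \<open>auto split: split_indicator\<close>)
  also have "\<dots> \<le> 1" by (rule nn_integral_exp_mart_le[OF l])
  finally have "ennreal (exp (a\<^sup>2 / (2 * v)) * prob ?A) \<le> ennreal 1"
    by (simp add: emeasure_eq_measure ennreal_mult)
  then have "exp (a\<^sup>2 / (2 * v)) * prob ?A \<le> 1" by (subst (asm) ennreal_le_iff) auto
  then show ?thesis by (simp add: exp_minus field_simps)
qed

text \<open>A discrete Tanaka formula. Moving the walker lowers the mean potential by the excess at
  its site, which pays for the growth of the squares at the next visit. A growing local time raises
  the potential at the walker by \<open>green 0 = 400\<close>, whence the coefficient 800.\<close>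

lemma sum_excess_sq_le:
  "(\<Sum>x\<in>S ` {..n}. (excess L S n x)\<^sup>2) \<le> 800 * (\<Sum>x\<in>S ` {..n}. excess L S n x) + 2 * mart L S n"
proof -
  define Q E where "Q k = (\<Sum>x\<in>S ` {..k}. (excess L S k x)\<^sup>2)" and "E k = (\<Sum>x\<in>S ` {..k}. excess L S k x)" for k
  \<comment> \<open>The inductive form keeps the boundary terms at the current site. Together they
    are nonnegative, because \<open>green 0 \<ge> 1\<close>, and are dropped at the end.\<close>
  have "Q n + 2 * potential L S n (S n) - 2 * excess L S n (S n) \<le> 800 * E n + 2 * mart L S n"
  proof (induction n)
    case 0
    have "excess L S 0 (S 0) = 0 \<or> excess L S 0 (S 0) = 1"
      by (cases L) (auto simp: excess_def local_time_def)
    then show ?case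
      by (auto simp: Q_def E_def potential_def mart_def green_0)
  next
    case (Suc n)
    define y e F where "y = S (Suc n)" and "e = excess L S n y" and "F = S ` {..Suc n}"
    define \<delta> where "\<delta> = excess L S (Suc n) y - e"
    have F: "finite F" "S ` {..n} \<subseteq> F" "y \<in> F" by (auto simp: F_def y_def)
    have \<delta>: "\<delta> = 0 \<or> \<delta> = 1"
      by (auto simp: \<delta>_def e_def excess_def local_time_Suc y_def)
    have ex: "excess L S (Suc n) z = excess L S n z + (if z = y then \<delta> else 0)" for z
      by (auto simp: \<delta>_def e_def excess_def local_time_Suc y_def)
    have y: "excess L S (Suc n) y = e + \<delta>" by (simp add: \<delta>_def)
    have e: "e \<ge> 0" by (simp add: e_def)
    have En: "E n = (\<Sum>x\<in>F. excess L S n x)"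
      unfolding E_def using sum_excess_superset[OF F(1,2), of "\<lambda>_ v. v"] by simp
    have Qn: "Q n = (\<Sum>x\<in>F. (excess L S n x)\<^sup>2)"
      unfolding Q_def using sum_excess_superset[OF F(1,2), of "\<lambda>_ v. v\<^sup>2"] by simp
    have Pn: "potential L S n x = (\<Sum>z\<in>F. excess L S n z * green (x - z))" for x
      unfolding potential_def using sum_excess_superset[OF F(1,2), of "\<lambda>z v. v * green (x - z)"] by simp
    have E': "E (Suc n) = E n + \<delta>"
      unfolding E_def[of "Suc n"] F_def[symmetric] En ex using F by (simp add: sum.distrib)
    have Q': "Q (Suc n) = Q n + (2 * e * \<delta> + \<delta>\<^sup>2)"
    proof -
      have "(excess L S (Suc n) x)\<^sup>2 = (excess L S n x)\<^sup>2 + (if x = y then 2 * e * \<delta> + \<delta>\<^sup>2 else 0)" for x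
        by (simp add: ex e_def power2_sum)
      then show ?thesis
        unfolding Q_def[of "Suc n"] F_def[symmetric] Qn using F by (simp add: sum.distrib)
    qed
    have "potential L S (Suc n) x = potential L S n x + (\<Sum>z\<in>F. if z = y then \<delta> * green (x - z) else 0)" for x
      unfolding potential_def[of L S "Suc n"] F_def[symmetric] Pn sum.distrib[symmetric] ex
      by (intro sum.cong) (auto simp: algebra_simps)
    then have P': "potential L S (Suc n) y = potential L S n y + 400 * \<delta>"
      using F by (simp add: green_0)
    have "mart L S (Suc n) = mart L S n + (potential L S n y - mean_potential L S n (S n))"
      by (simp add: mart_def y_def)
    then have "potential L S n y \<le> potential L S n (S n) - excess L S n (S n) + mart L S (Suc n) - mart L S n"
      using mean_potential_le[of L S n] by linarith
    moreover define g where "g = 2 * e * \<delta> + \<delta>\<^sup>2"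
    \<comment> \<open>\<open>\<delta>\<close> is 0 or 1, so the growth of the squares is at most
      twice the new boundary term \<open>e + \<delta>\<close>.\<close>
    moreover have "g \<le> 2 * e + 2 * \<delta>" using \<delta> e by (auto simp: g_def)
    ultimately show ?case
      using Suc.IH unfolding y_def[symmetric] y Q' E' P' g_def[symmetric] by (simp add: algebra_simps)
  qed
  moreover have "excess L S n (S n) \<le> potential L S n (S n)"
  proof -
    have "excess L S n (S n) * 1 \<le> excess L S n (S n) * green (S n - S n)"
      by (intro mult_left_mono) (auto simp: green_0)
    also have "\<dots> \<le> potential L S n (S n)"
      unfolding potential_def
      by (rule member_le_sum[where f = "\<lambda>z. excess L S n z * green (S n - z)"])
        (auto intro!: mult_nonneg_nonneg intro: less_imp_le green_pos)
    finally show ?thesis by simp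
  qed
  ultimately show ?thesis unfolding Q_def E_def by linarith
qed

text \<open>The excess grows in time, so every slope is dominated by the kernel sum with the final
  excess. The sum over times then becomes a sum over sites weighted by local time, to which
  \<open>convolution_le\<close> applies.\<close>

lemma quadvar_le:
  assumes "\<rho> > 0"
  shows "quadvar L S n \<le> 24000\<^sup>2 * (6400 * sqrt (\<Sum>x\<in>S ` {..n}. (real (local_time S n x))\<^sup>2) *
      sqrt (\<Sum>x\<in>S ` {..n}. (excess L S n x)\<^sup>2) *
      (sqrt \<rho> * sqrt (\<Sum>x\<in>S ` {..n}. (excess L S n x)\<^sup>2) + (\<Sum>x\<in>S ` {..n}. excess L S n x) / \<rho>))"
proof -
  let ?F = "S ` {..n}"
  let ?K = "\<lambda>x. \<Sum>z\<in>?F. excess L S n z / bump (x - z)"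
  have "(slope L S k)\<^sup>2 \<le> 24000\<^sup>2 * (?K (S k))\<^sup>2" if "k \<le> n" for k
  proof -
    have "(\<Sum>z\<in>S ` {..k}. excess L S k z / bump (S k - z)) = (\<Sum>z\<in>?F. excess L S k z / bump (S k - z))"
      using that by (intro sum_excess_superset[of _ _ _ "\<lambda>z v. v / bump (S k - z)", symmetric]) auto
    also have "\<dots> \<le> ?K (S k)"
      using that by (intro sum_mono divide_right_mono excess_mono) (auto intro: less_imp_le)
    finally have "slope L S k \<le> 24000 * ?K (S k)" by (simp add: slope_def)
    then have "(slope L S k)\<^sup>2 \<le> (24000 * ?K (S k))\<^sup>2" by (intro power_mono slope_nonneg)
    then show ?thesis by (simp only: power_mult_distrib)
  qed
  then have "quadvar L S n \<le> (\<Sum>k<n. 24000\<^sup>2 * (?K (S k))\<^sup>2)"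
    unfolding quadvar_def by (intro sum_mono) auto
  also have "\<dots> \<le> (\<Sum>k\<le>n. 24000\<^sup>2 * (?K (S k))\<^sup>2)" by (intro sum_mono2) auto
  also have "\<dots> = 24000\<^sup>2 * (\<Sum>x\<in>?F. real (local_time S n x) * (?K x)\<^sup>2)"
    by (subst sum_local_time_mult) (auto simp: sum_distrib_left)
  also have "\<dots> \<le> 24000\<^sup>2 * (6400 * sqrt (\<Sum>x\<in>?F. (real (local_time S n x))\<^sup>2) *
      sqrt (\<Sum>x\<in>?F. (excess L S n x)\<^sup>2) *
      (sqrt \<rho> * sqrt (\<Sum>x\<in>?F. (excess L S n x)\<^sup>2) + (\<Sum>x\<in>?F. excess L S n x) / \<rho>))"
    by (intro mult_left_mono convolution_le assms) auto
  finally show ?thesis .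
qed

section \<open>Confinement in a cube\<close>

text \<open>Local time vanishes off the range, so this finite sum equals the infinite sum over the
  lattice.\<close>

definition energy :: "(nat \<Rightarrow> 'a) \<Rightarrow> nat \<Rightarrow> real" where
  "energy S n = (\<Sum>x\<in>S ` {..n}. (real (local_time S n x))\<^sup>2)"

lemma infsum_local_time_sq:
  "(\<Sum>\<^sub>\<infinity>x\<in>A. (real (local_time S n x))\<^sup>2) = (\<Sum>x\<in>S ` {..n} \<inter> A. (real (local_time S n x))\<^sup>2)"
proof -
  have "(\<Sum>\<^sub>\<infinity>x\<in>A. (real (local_time S n x))\<^sup>2) = (\<Sum>\<^sub>\<infinity>x\<in>S ` {..n} \<inter> A. (real (local_time S n x))\<^sup>2)"
    using local_time_eq_0_iff[of S n] by (intro infsum_cong_neutral) auto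
  then show ?thesis by simp
qed

lemma infsum_eq_energy: "(\<Sum>\<^sub>\<infinity>x. (real (local_time S n x))\<^sup>2) = energy S n"
  unfolding infsum_local_time_sq energy_def by simp

lemma energy_cong: "(\<And>k. k \<le> n \<Longrightarrow> S k = S' k) \<Longrightarrow> energy S n = energy S' n"
  unfolding energy_def using local_time_cong[of n S S'] image_cong_prefix[of n S S'] by simp

section \<open>The eigenfunction of the walk killed outside a cube\<close>

definition cube :: "nat \<Rightarrow> (int ^ 3) set" where
  "cube r = {x. \<forall>i. \<bar>x $ i\<bar> \<le> int r}"

text \<open>The factors vanish at the coordinates \<open>r + 1\<close> and \<open>-(r + 1)\<close>,
  one step outside the cube.\<close>

definition cosprod :: "nat \<Rightarrow> int ^ 3 \<Rightarrow> real" where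
  "cosprod r x = (\<Prod>i\<in>UNIV. cos (pi / (2 * (real r + 1)) * real_of_int (x $ i)))"

lemma card_cube: "finite (cube r)" "card (cube r) = (2 * r + 1) ^ 3"
proof -
  have eq: "cube r = {x. \<forall>i. x $ i \<in> {- int r..int r}}"
    by (auto simp: cube_def abs_le_iff minus_le_iff)
  show "finite (cube r)" unfolding eq by (rule finite_card_vec_PiE) simp
  have "card (cube r) = (\<Prod>i\<in>(UNIV :: 3 set). card {- int r..int r})"
    unfolding eq by (rule finite_card_vec_PiE) simp
  moreover have "card {- int r..int r} = 2 * r + 1" by simp
  ultimately show "card (cube r) = (2 * r + 1) ^ 3" by (simp only: prod_constant) simp
qed

lemma cosprod_nonneg:
  assumes "x \<in> cube r"
  shows "0 \<le> cosprod r x"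
  unfolding cosprod_def
proof (rule prod_nonneg)
  fix i
  have "\<bar>x $ i\<bar> \<le> int r" using assms by (simp add: cube_def)
  then have "real_of_int \<bar>x $ i\<bar> \<le> real_of_int (int r)" by (simp only: of_int_le_iff)
  then have "\<bar>real_of_int (x $ i)\<bar> \<le> real r + 1" by simp
  then have "pi / (2 * (real r + 1)) * \<bar>real_of_int (x $ i)\<bar> \<le> pi / (2 * (real r + 1)) * (real r + 1)"
    by (intro mult_left_mono) auto
  also have "\<dots> = pi / 2" by (simp add: field_simps)
  finally have "\<bar>pi / (2 * (real r + 1)) * real_of_int (x $ i)\<bar> \<le> pi / 2"
    by (simp add: abs_mult)
  then show "0 \<le> cos (pi / (2 * (real r + 1)) * real_of_int (x $ i))"
    by (intro cos_ge_zero) linarith+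
qed

lemma cosprod_le_1: "cosprod r x \<le> 1"
proof -
  have "\<bar>cosprod r x\<bar> = (\<Prod>i\<in>UNIV. \<bar>cos (pi / (2 * (real r + 1)) * real_of_int (x $ i))\<bar>)"
    by (simp add: cosprod_def abs_prod)
  also have "\<dots> \<le> 1" by (intro prod_le_1) auto
  finally show ?thesis by linarith
qed

lemma cosprod_step:
  "cosprod r (x + axis i c) = cos (pi / (2 * (real r + 1)) * (real_of_int (x $ i) + real_of_int c)) *
    (\<Prod>j\<in>UNIV - {i}. cos (pi / (2 * (real r + 1)) * real_of_int (x $ j)))"
proof -
  have "cosprod r (x + axis i c) = cos (pi / (2 * (real r + 1)) * real_of_int ((x + axis i c) $ i)) *
    (\<Prod>j\<in>UNIV - {i}. cos (pi / (2 * (real r + 1)) * real_of_int ((x + axis i c) $ j)))"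
    unfolding cosprod_def by (rule prod.remove) auto
  moreover have "(\<Prod>j\<in>UNIV - {i}. cos (pi / (2 * (real r + 1)) * real_of_int ((x + axis i c) $ j))) =
      (\<Prod>j\<in>UNIV - {i}. cos (pi / (2 * (real r + 1)) * real_of_int (x $ j)))"
    by (intro prod.cong) (auto simp: axis_def)
  ultimately show ?thesis by (simp add: axis_def)
qed

text \<open>Only the coordinate that moved can leave, and it lands exactly on a zero of its cosine.
  Killing on exit therefore does not change the expectation of \<open>cosprod\<close>.\<close>

lemma cosprod_exit:
  assumes "x \<in> cube r" "s \<in> set_pmf srw_step" "x + s \<notin> cube r"
  shows "cosprod r (x + s) = 0"
proof -
  obtain i c where s: "s = axis i c" and c: "c = 1 \<or> c = -1"
    using assms(2) by (auto simp: set_pmf_srw_step)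
  have x: "\<bar>x $ j\<bar> \<le> int r" for j using assms(1) by (simp add: cube_def)
  obtain j where j: "\<not> \<bar>(x + s) $ j\<bar> \<le> int r" using assms(3) by (auto simp: cube_def)
  have "j = i"
  proof (rule ccontr)
    assume "j \<noteq> i"
    then have "(x + s) $ j = x $ j" by (simp add: s axis_def)
    then show False using j x[of j] by simp
  qed
  then have "\<not> \<bar>x $ i + c\<bar> \<le> int r" using j by (simp add: s axis_def)
  then have "x $ i + c = int r + 1 \<or> x $ i + c = - (int r + 1)" using x[of i] c by linarith
  then have "real_of_int (x $ i) + real_of_int c = real r + 1 \<or> real_of_int (x $ i) + real_of_int c = - (real r + 1)"
    by (metis of_int_1 of_int_add of_int_minus of_int_of_nat_eq)
  then have "cos (pi / (2 * (real r + 1)) * (real_of_int (x $ i) + real_of_int c)) = 0"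
  proof
    assume "real_of_int (x $ i) + real_of_int c = real r + 1"
    then have "pi / (2 * (real r + 1)) * (real_of_int (x $ i) + real_of_int c) = pi / 2" by (simp add: divide_simps)
    then show ?thesis by (simp only: cos_pi_half)
  next
    assume "real_of_int (x $ i) + real_of_int c = - (real r + 1)"
    moreover have "pi / (2 * R) * (- R) = - (pi / 2)" if "R > 0" for R :: real using that by simp
    from this[of "real r + 1"] have "pi / (2 * (real r + 1)) * - (real r + 1) = - (pi / 2)" by simp
    ultimately have "pi / (2 * (real r + 1)) * (real_of_int (x $ i) + real_of_int c) = - (pi / 2)" by (simp only:)
    then show ?thesis by (simp only: cos_minus cos_pi_half)
  qed
  then show ?thesis by (simp add: s cosprod_step)
qed

lemma cosprod_eigen:
  "measure_pmf.expectation srw_step (\<lambda>s. cosprod r (x + s)) = cos (pi / (2 * (real r + 1))) * cosprod r x"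
proof -
  let ?t = "pi / (2 * (real r + 1))"
  have "cosprod r (x + axis i 1) + cosprod r (x + axis i (-1)) = 2 * cos ?t * cosprod r x" for i
  proof -
    let ?P = "\<Prod>j\<in>UNIV - {i}. cos (?t * real_of_int (x $ j))" and ?u = "?t * real_of_int (x $ i)"
    have "cosprod r (x + axis i 1) + cosprod r (x + axis i (-1)) = (cos (?u + ?t) + cos (?u - ?t)) * ?P"
      unfolding cosprod_step by (simp only: of_int_1 of_int_minus distrib_left mult_1_right mult_minus_right distrib_right) simp
    also have "cos (?u + ?t) + cos (?u - ?t) = 2 * cos ?t * cos ?u"
      by (simp add: cos_add cos_diff)
    also have "2 * cos ?t * cos ?u * ?P = 2 * cos ?t * cosprod r x"
      \<comment> \<open>A step of size 0 splits off the factor of coordinate \<open>i\<close> from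
        \<open>cosprod r x\<close> itself.\<close>
      using cosprod_step[of r x i 0] by (simp add: axis_eq_0_iff axis_def zero_vec_def[symmetric])
    finally show ?thesis .
  qed
  then show ?thesis by (simp add: expectation_srw_step)
qed

text \<open>Each step of the killed walk multiplies the expectation of the eigenfunction by its
  eigenvalue, starting from the value 1 at the origin.\<close>

lemma nn_integral_confined:
  "(\<integral>\<^sup>+S. ennreal (if \<forall>k\<le>n. S k \<in> cube r then cosprod r (S n) else 0) \<partial>srw 0)
    = ennreal (cos (pi / (2 * (real r + 1))) ^ n)"
proof (induction n)
  case 0
  have "adapted 0 (\<lambda>S. ennreal (if \<forall>k\<le>0. S k \<in> cube r then cosprod r (S 0) else 0))"
    by (rule adaptedI) simp
  from nn_integral_srw_0[OF this, of 0] show ?case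
    by (simp add: cube_def cosprod_def)
next
  case (Suc n)
  let ?t = "pi / (2 * (real r + 1))"
  have t: "cos ?t \<ge> 0" by (intro cos_ge_zero) (auto simp: field_simps intro: order_trans[of _ 0])
  let ?G = "\<lambda>n S. if \<forall>k\<le>n. S k \<in> cube r then cosprod r (S n) else 0"
  have ad: "adapted (Suc n) (\<lambda>S. ennreal (?G (Suc n) S))"
  proof (rule adaptedI)
    fix S S' :: "nat \<Rightarrow> int ^ 3" assume e: "\<And>k. k \<le> Suc n \<Longrightarrow> S k = S' k"
    then have "(\<forall>k\<le>Suc n. S k \<in> cube r) \<longleftrightarrow> (\<forall>k\<le>Suc n. S' k \<in> cube r)" by auto
    moreover have "S (Suc n) = S' (Suc n)" using e by simp
    ultimately show "ennreal (?G (Suc n) S) = ennreal (?G (Suc n) S')" by (simp only:)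
  qed
  have inner: "(\<integral>\<^sup>+s. ennreal (?G (Suc n) (S(Suc n := S n + s))) \<partial>measure_pmf srw_step) =
      ennreal (cos ?t) * ennreal (?G n S)" for S
  proof (cases "\<forall>k\<le>n. S k \<in> cube r")
    case True
    have cp: "0 \<le> cosprod r (S n + s) \<and> ?G (Suc n) (S(Suc n := S n + s)) = cosprod r (S n + s)"
      if "s \<in> set_pmf srw_step" for s
      using cosprod_exit[of "S n" r s] cosprod_nonneg[of "S n + s" r] True that
      by (cases "S n + s \<in> cube r") (auto simp: le_Suc_eq)
    have "(\<integral>\<^sup>+s. ennreal (?G (Suc n) (S(Suc n := S n + s))) \<partial>measure_pmf srw_step) =
        (\<integral>\<^sup>+s. ennreal (cosprod r (S n + s)) \<partial>measure_pmf srw_step)"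
      by (intro nn_integral_cong_AE AE_pmfI) (simp only: cp)
    also have "\<dots> = ennreal (measure_pmf.expectation srw_step (\<lambda>s. cosprod r (S n + s)))"
      by (intro nn_integral_eq_integral integrable_srw_step AE_pmfI) (simp only: cp)
    also have "\<dots> = ennreal (cos ?t * cosprod r (S n))" by (simp only: cosprod_eigen)
    also have "\<dots> = ennreal (cos ?t) * ennreal (?G n S)"
      using True t cosprod_nonneg[of "S n" r] by (simp add: ennreal_mult)
    finally show ?thesis .
  next
    case False
    then obtain k where k: "k \<le> n" "S k \<notin> cube r" by blast
    have "?G (Suc n) (S(Suc n := S n + s)) = 0" for s
    proof -
      have "\<not> (\<forall>k\<le>Suc n. (S(Suc n := S n + s)) k \<in> cube r)"
        using k by (intro notI) (auto dest!: spec[of _ k])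
      then show ?thesis by (rule if_not_P)
    qed
    moreover have "?G n S = 0" using False by (rule if_not_P)
    ultimately show ?thesis by (simp only: ennreal_0 mult_zero_right nn_integral_const mult_zero_left)
  qed
  have gm: "(\<lambda>S. ennreal (?G n S)) \<in> borel_measurable (srw 0)"
  proof (rule measurable_adapted_srw[of n], rule adaptedI)
    fix S S' :: "nat \<Rightarrow> int ^ 3" assume e: "\<And>k. k \<le> n \<Longrightarrow> S k = S' k"
    then have "(\<forall>k\<le>n. S k \<in> cube r) \<longleftrightarrow> (\<forall>k\<le>n. S' k \<in> cube r)" by auto
    moreover have "S n = S' n" using e by simp
    ultimately show "ennreal (?G n S) = ennreal (?G n S')" by (simp only:)
  qed
  have "(\<integral>\<^sup>+S. ennreal (?G (Suc n) S) \<partial>srw 0) = (\<integral>\<^sup>+S. ennreal (cos ?t) * ennreal (?G n S) \<partial>srw 0)"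
    by (subst nn_integral_srw_Suc[OF ad]) (simp only: inner)
  also have "\<dots> = ennreal (cos ?t) * ennreal (cos ?t ^ n)"
    by (subst nn_integral_cmult[OF gm]) (simp only: Suc.IH)
  also have "\<dots> = ennreal (cos ?t ^ Suc n)" using t by (simp add: ennreal_mult)
  finally show ?case .
qed

text \<open>Cauchy-Schwarz: a total local time of \<open>n + 1\<close> is spread over no more sites
  than the cube has.\<close>

lemma energy_confined:
  assumes "\<forall>k\<le>n. S k \<in> cube r"
  shows "(real n + 1)\<^sup>2 \<le> real ((2 * r + 1) ^ 3) * energy S n"
proof -
  have "card (S ` {..n}) \<le> card (cube r)" using assms by (intro card_mono card_cube) auto
  then have c: "real (card (S ` {..n})) \<le> real ((2 * r + 1) ^ 3)" by (simp only: card_cube of_nat_le_iff)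
  have "(real n + 1)\<^sup>2 = (\<Sum>x\<in>S ` {..n}. 1 * real (local_time S n x))\<^sup>2"
    using sum_local_time[of "S ` {..n}" S n] by simp
  also have "\<dots> \<le> (\<Sum>x\<in>S ` {..n}. 1\<^sup>2) * (\<Sum>x\<in>S ` {..n}. (real (local_time S n x))\<^sup>2)"
    by (rule Cauchy_Schwarz_ineq_sum)
  also have "\<dots> = real (card (S ` {..n})) * energy S n" by (simp add: energy_def)
  also have "\<dots> \<le> real ((2 * r + 1) ^ 3) * energy S n"
    using c by (intro mult_right_mono) (auto simp: energy_def intro: sum_nonneg)
  finally show ?thesis .
qed

lemma prob_confined_ge:
  "cos (pi / (2 * (real r + 1))) ^ n \<le> measure (srw 0) {S. \<forall>k\<le>n. S k \<in> cube r}"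
proof -
  interpret prob_space "srw (0 :: int ^ 3)" by (rule prob_space_srw)
  let ?A = "{S. \<forall>k\<le>n. S k \<in> cube r}"
  have A: "?A \<in> events"
  proof (rule sets_adapted_srw[of n], rule adaptedI)
    fix S S' :: "nat \<Rightarrow> int ^ 3" assume e: "\<And>k. k \<le> n \<Longrightarrow> S k = S' k"
    then show "(\<forall>k\<le>n. S k \<in> cube r) = (\<forall>k\<le>n. S' k \<in> cube r)" by auto
  qed
  have "ennreal (cos (pi / (2 * (real r + 1))) ^ n) =
      (\<integral>\<^sup>+S. ennreal (if \<forall>k\<le>n. S k \<in> cube r then cosprod r (S n) else 0) \<partial>srw 0)"
    by (rule nn_integral_confined[symmetric])
  also have "\<dots> \<le> (\<integral>\<^sup>+S. indicator ?A S \<partial>srw 0)"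
    using cosprod_le_1 by (intro nn_integral_mono) (auto split: split_indicator)
  also have "\<dots> = ennreal (prob ?A)" using A by (simp add: emeasure_eq_measure)
  finally show ?thesis by simp
qed

text \<open>With \<open>u = t\<^sup>2\<close> the chain runs through 1/(1 + u) and 1 - u/2, the
  middle inequality using u \<le> 1.\<close>

lemma exp_le_cos:
  fixes t :: real
  assumes "\<bar>t\<bar> \<le> 1"
  shows "exp (- t\<^sup>2) \<le> cos t"
proof -
  define u where "u = t\<^sup>2"
  have u: "0 \<le> u" "u \<le> 1" using assms by (auto simp: u_def abs_square_le_1)
  have "exp (- u) \<le> 1 / (1 + u)"
    using exp_ge_add_one_self[of u] u by (simp add: exp_minus field_simps)
  also have "\<dots> \<le> 1 - u / 2"
  proof -
    have "u * u \<le> u * 1" using u by (intro mult_left_mono) auto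
    then have "1 \<le> (1 - u / 2) * (1 + u)" by (simp add: algebra_simps)
    then show ?thesis using u by (simp add: pos_divide_le_eq)
  qed
  also have "\<dots> \<le> cos t"
  proof -
    have "(sin (t / 2))\<^sup>2 \<le> (t / 2)\<^sup>2"
      using abs_sin_x_le_abs_x[of "t / 2"] by (simp only: abs_le_square_iff)
    then show ?thesis using cos_double_sin[of "t / 2"] by (simp add: u_def power_divide)
  qed
  finally show ?thesis by (simp add: u_def)
qed

lemma energy_lower_tail:
  assumes y: "y > 0" and a: "(real n / y) powr (1/3) \<ge> 4"
  shows "exp (- 64 * y powr (2/3) * real n powr (1/3)) \<le> measure (srw 0) {S :: nat \<Rightarrow> int ^ 3. energy S n > real n * y}"
proof -
  interpret prob_space "srw (0 :: int ^ 3)" by (rule prob_space_srw)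
  have n: "n > 0" using a by (cases n) auto
  define m u where "m = real n powr (1/3)" and "u = y powr (1/3)"
  have mu: "m > 0" "u > 0" using n y by (auto simp: m_def u_def)
  have m3: "m ^ 3 = real n" and u3: "u ^ 3 = y" using n y by (simp_all add: m_def u_def powr_power)
  have u2: "y powr (2/3) = u\<^sup>2" using y by (simp add: u_def powr_power)
  define d where "d = m / u"
  have d4: "d \<ge> 4" using a n y by (simp add: d_def m_def u_def powr_divide)
  \<comment> \<open>Since \<open>d \<ge> 4\<close>, this gives \<open>2 * r + 1 < d\<close>, so
    confinement to the cube forces energy above \<open>n\<^sup>2 / d ^ 3\<close>, which is
    \<open>n * y\<close>.\<close>
  define r where "r = nat \<lfloor>d / 4\<rfloor>"
  have r1: "real r \<le> d / 4" and r2: "d / 4 \<le> real r + 1" and r3: "real r \<ge> 1"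
    using d4 unfolding r_def by (simp_all add: of_nat_floor, linarith+)
  have cube_small: "real ((2 * r + 1) ^ 3) < d ^ 3"
  proof -
    have "real (2 * r + 1) < d" using r1 d4 by simp
    then have "real (2 * r + 1) ^ 3 < d ^ 3" by (intro power_strict_mono) auto
    then show ?thesis by (simp only: of_nat_power)
  qed
  have "{S. \<forall>k\<le>n. S k \<in> cube r} \<subseteq> {S. energy S n > real n * y}"
  proof safe
    fix S :: "nat \<Rightarrow> int ^ 3" assume "\<forall>k\<le>n. S k \<in> cube r"
    from energy_confined[OF this]
    have e: "(real n + 1)\<^sup>2 \<le> real ((2 * r + 1) ^ 3) * energy S n" .
    have "real n * y * d ^ 3 = (real n)\<^sup>2"
      using mu by (simp add: d_def m3[symmetric] u3[symmetric] power_divide power2_eq_square)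
    also have "\<dots> < (real n + 1)\<^sup>2" by (intro power_strict_mono) auto
    also have "\<dots> \<le> real ((2 * r + 1) ^ 3) * energy S n" by (rule e)
    also have "\<dots> \<le> d ^ 3 * energy S n"
      using cube_small by (intro mult_right_mono) (auto simp: energy_def intro: sum_nonneg)
    finally have "d ^ 3 * (real n * y) < d ^ 3 * energy S n" by (simp add: mult.commute)
    then show "real n * y < energy S n" using d4 by (simp add: mult_less_cancel_left_pos)
  qed
  moreover have "{S :: nat \<Rightarrow> int ^ 3. energy S n > real n * y} \<in> events"
  proof (rule sets_adapted_srw[of n], rule adaptedI)
    fix S S' :: "nat \<Rightarrow> int ^ 3" assume "\<And>k. k \<le> n \<Longrightarrow> S k = S' k"
    from energy_cong[OF this] show "(energy S n > real n * y) = (energy S' n > real n * y)" by simp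
  qed
  ultimately have "prob {S. \<forall>k\<le>n. S k \<in> cube r} \<le> prob {S. energy S n > real n * y}"
    by (rule finite_measure_mono)
  moreover have "exp (- 64 * y powr (2/3) * real n powr (1/3)) \<le> cos (pi / (2 * (real r + 1))) ^ n"
  proof -
    define t where "t = pi / (2 * (real r + 1))"
    have t: "0 \<le> t" "t \<le> 1" using r3 pi_less_4 pi_ge_zero by (simp_all only: t_def) (simp_all add: pos_divide_le_eq)
    \<comment> \<open>The angle is at most 8/d, so the cost n t^2 is at most 64 n/d^2, which is the
      exponent claimed.\<close>
    have "t \<le> 4 / (2 * (d / 4))"
      unfolding t_def using r2 d4 pi_less_4 by (intro frac_le) auto
    then have "t\<^sup>2 \<le> (4 / (2 * (d / 4)))\<^sup>2" using t by (intro power_mono) auto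
    also have "\<dots> = 64 / d\<^sup>2" by (simp add: power_divide power_mult_distrib)
    finally have "real n * t\<^sup>2 \<le> real n * (64 / d\<^sup>2)" by (intro mult_left_mono) auto
    also have "\<dots> = 64 * y powr (2/3) * real n powr (1/3)"
      unfolding m_def[symmetric] u2 unfolding m3[symmetric] d_def using mu
      by (simp add: power_divide power2_eq_square power3_eq_cube)
    finally have "exp (- 64 * y powr (2/3) * real n powr (1/3)) \<le> exp (- (real n * t\<^sup>2))" by simp
    also have "\<dots> = exp (- t\<^sup>2) ^ n" by (simp add: exp_of_nat_mult[symmetric])
    also have "\<dots> \<le> cos t ^ n" using t by (intro power_mono exp_le_cos) auto
    finally show ?thesis by (simp add: t_def)
  qed
  ultimately show ?thesis using prob_confined_ge[of r n] by linarith
qed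

section \<open>Tail bounds for the energy\<close>

lemma energy_0: "energy S 0 = 1"
  by (simp add: energy_def local_time_def)

lemma energy_nonneg: "energy S n \<ge> 0"
  by (simp add: energy_def sum_nonneg)

lemma local_time_sq_le_energy: "(real (local_time S n x))\<^sup>2 \<le> energy S n"
proof (cases "x \<in> S ` {..n}")
  case True
  then show ?thesis unfolding energy_def
    by (intro member_le_sum[where f = "\<lambda>x. (real (local_time S n x))\<^sup>2"]) auto
next
  case False
  then show ?thesis using local_time_eq_0_iff[of S n x] energy_nonneg[of S n] by simp
qed

lemma energy_Suc: "energy S (Suc n) = energy S n + 2 * real (local_time S n (S (Suc n))) + 1"
proof -
  let ?F = "S ` {..Suc n}" and ?y = "S (Suc n)"
  have e: "energy S n = (\<Sum>x\<in>?F. (real (local_time S n x))\<^sup>2)"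
    unfolding energy_def using local_time_eq_0_iff[of S n] by (intro sum.mono_neutral_left) auto
  have "(real (local_time S (Suc n) x))\<^sup>2 = (real (local_time S n x))\<^sup>2 +
      (if x = ?y then 2 * real (local_time S n ?y) + 1 else 0)" for x
    by (auto simp: local_time_Suc power2_eq_square algebra_simps)
  then show ?thesis unfolding e energy_def[of S "Suc n"] by (simp add: sum.distrib)
qed

text \<open>At the first crossing the overshoot is bounded: one step adds 2 l + 1, where the
  previous local time l satisfies l^2 \<le> q. The upper bound at this time is what controls the
  quadratic variation.\<close>

lemma energy_crossing:
  assumes "q \<ge> 1" "energy S n > q"
  shows "\<exists>k\<in>{1..n}. q < energy S k \<and> energy S k \<le> 4 * q"
proof -
  define k where "k = (LEAST k. q < energy S k)"
  have k: "q < energy S k" unfolding k_def using assms(2) by (rule LeastI)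
  have kn: "k \<le> n" unfolding k_def using assms(2) by (rule Least_le)
  have "k \<noteq> 0"
  proof
    assume "k = 0"
    then show False using k assms(1) by (simp add: energy_0)
  qed
  then obtain j where j: "k = Suc j" using not0_implies_Suc by blast
  have ej: "energy S j \<le> q" using not_less_Least[of j "\<lambda>k. q < energy S k"] j unfolding k_def by auto
  have "real (local_time S j (S k)) \<le> q"
  proof -
    have "(real (local_time S j (S k)))\<^sup>2 \<le> q * 1"
      using local_time_sq_le_energy[of S j "S k"] ej by simp
    also have "\<dots> \<le> q\<^sup>2" unfolding power2_eq_square using assms(1) by (intro mult_left_mono) auto
    finally show ?thesis using assms(1) by (simp add: power2_le_iff_abs_le)
  qed
  then have "energy S k \<le> 4 * q" using ej assms(1) by (simp add: j energy_Suc)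
  then show ?thesis using k kn \<open>k \<noteq> 0\<close> by (intro bexI[of _ k]) auto
qed

section \<open>Deviation bounds from the martingale tail\<close>

abbreviation qv_const :: real where
  "qv_const \<equiv> 24000\<^sup>2 * 6400"

lemma quadvar_le_bounds:
  assumes \<rho>: "\<rho> > 0" and e: "energy S n \<le> e"
    and x: "(\<Sum>x\<in>S ` {..n}. (excess L S n x)\<^sup>2) \<le> e" and c: "(\<Sum>x\<in>S ` {..n}. excess L S n x) \<le> c"
  shows "quadvar L S n \<le> qv_const * (e * (sqrt \<rho> * sqrt e + c / \<rho>))"
proof -
  have e0: "e \<ge> 0" using e energy_nonneg[of S n] by linarith
  have "quadvar L S n \<le> 24000\<^sup>2 * (6400 * sqrt (energy S n) * sqrt (\<Sum>x\<in>S ` {..n}. (excess L S n x)\<^sup>2) *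
      (sqrt \<rho> * sqrt (\<Sum>x\<in>S ` {..n}. (excess L S n x)\<^sup>2) + (\<Sum>x\<in>S ` {..n}. excess L S n x) / \<rho>))"
    unfolding energy_def by (rule quadvar_le[OF \<rho>])
  also have "\<dots> \<le> 24000\<^sup>2 * (6400 * sqrt e * sqrt e * (sqrt \<rho> * sqrt e + c / \<rho>))"
    using \<rho> e x c e0
    by (intro mult_left_mono mult_mono add_mono divide_right_mono real_sqrt_le_mono order_refl)
      (auto intro!: sum_nonneg mult_nonneg_nonneg add_nonneg_nonneg divide_nonneg_nonneg energy_nonneg)
  also have "6400 * sqrt e * sqrt e = 6400 * e" using e0 by (simp add: mult.assoc)
  finally show ?thesis by (simp only: mult.assoc)
qed

lemma sets_energy [intro]:
  "{S :: nat \<Rightarrow> int ^ 'd::finite. q < energy S n} \<in> sets (srw x)"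
proof (rule sets_adapted_srw[of n], rule adaptedI)
  fix S S' :: "nat \<Rightarrow> int ^ 'd" assume "\<And>k. k \<le> n \<Longrightarrow> S k = S' k"
  from energy_cong[OF this] show "(q < energy S n) = (q < energy S' n)" by simp
qed

lemma sets_mart [intro]: "{S. a \<le> mart L S n \<and> quadvar L S n \<le> v} \<in> sets (srw x)"
proof (rule sets_adapted_srw[of n], rule adaptedI)
  fix S S' :: "nat \<Rightarrow> int ^ 3" assume e: "\<And>k. k \<le> n \<Longrightarrow> S k = S' k"
  have "mart L S n = mart L S' n" by (rule mart_cong) (rule e)
  moreover have "quadvar L S n = quadvar L S' n" by (rule quadvar_cong) (use e in simp)
  ultimately show "(a \<le> mart L S n \<and> quadvar L S n \<le> v) = (a \<le> mart L S' n \<and> quadvar L S' n \<le> v)" by simp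
qed

text \<open>A union bound over the crossing time. At that time the term 800 * 2n is at most half of
  the energy level, as \<open>y \<ge> 3200\<close>, so the martingale must reach a quarter of the
  level while its quadratic variation is bounded.\<close>

lemma energy_upper_tail:
  assumes n: "n \<ge> 1" and y: "y \<ge> 3200"
  shows "measure (srw 0) {S :: nat \<Rightarrow> int ^ 3. energy S n > real n * y}
    \<le> real n * exp (- (y powr (2/3) * real n powr (1/3) / (512 * qv_const)))"
proof -
  interpret prob_space "srw (0 :: int ^ 3)" by (rule prob_space_srw)
  define m u where "m = real n powr (1/3)" and "u = y powr (1/3)"
  have mu: "m > 0" "u > 0" using n y by (auto simp: m_def u_def)
  have m3: "real n = m ^ 3" and u3: "y = u ^ 3" using n y by (simp_all add: m_def u_def powr_power)
  have u2: "y powr (2/3) = u\<^sup>2" using y by (simp add: u_def powr_power)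
  define a v where "a = real n * y / 4" and "v = 16 * qv_const * (m ^ 5 * u ^ 4)"
  have av: "a > 0" "v > 0" using mu n y by (auto simp: a_def v_def)
  have ny: "real n * y \<ge> 1" using mult_mono[of 1 "real n" 1 y] n y by simp
  let ?A = "\<lambda>k. {S. a \<le> mart 0 S k \<and> quadvar 0 S k \<le> v}"
  have "{S :: nat \<Rightarrow> int ^ 3. energy S n > real n * y} \<subseteq> (\<Union>k\<in>{1..n}. ?A k)"
  proof
    fix S :: "nat \<Rightarrow> int ^ 3" assume "S \<in> {S. energy S n > real n * y}"
    then obtain k where k: "k \<in> {1..n}" "real n * y < energy S k" "energy S k \<le> 4 * (real n * y)"
      using energy_crossing[OF ny, of S n] by auto
    have c: "(\<Sum>x\<in>S ` {..k}. excess 0 S k x) \<le> 2 * real n"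
      using sum_local_time[of "S ` {..k}" S k] k(1) n by simp
    have "energy S k \<le> 800 * (2 * real n) + 2 * mart 0 S k"
      using sum_excess_sq_le[of 0 S k] c by (simp add: energy_def)
    moreover have "real n * 3200 \<le> real n * y" using y by (intro mult_left_mono) auto
    ultimately have "a \<le> mart 0 S k" using k(2) by (simp add: a_def)
    moreover have "quadvar 0 S k \<le> v"
    proof -
      \<comment> \<open>The radius \<open>m / u\<close>, which is (n/y)^(1/3), makes the near and
        far terms equal.\<close>
      have "quadvar 0 S k \<le> qv_const * (4 * (real n * y) * (sqrt (m / u) * sqrt (4 * (real n * y)) + 2 * real n / (m / u)))"
        by (rule quadvar_le_bounds) (use mu k c in \<open>auto simp: energy_def\<close>)
      also have "sqrt (m / u) * sqrt (4 * (real n * y)) = 2 * (m\<^sup>2 * u)"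
      proof -
        have "m / u * (4 * (real n * y)) = (2 * (m\<^sup>2 * u))\<^sup>2"
          unfolding m3 u3 using mu by (simp add: field_simps eval_nat_numeral)
        then have "sqrt (m / u * (4 * (real n * y))) = 2 * (m\<^sup>2 * u)" using mu by (simp only: real_sqrt_abs) simp
        then show ?thesis by (simp only: real_sqrt_mult)
      qed
      also have "2 * real n / (m / u) = 2 * (m\<^sup>2 * u)"
        unfolding m3 using mu by (simp add: field_simps eval_nat_numeral)
      also have "qv_const * (4 * (real n * y) * (2 * (m\<^sup>2 * u) + 2 * (m\<^sup>2 * u))) = v"
        unfolding m3 u3 v_def by (simp add: eval_nat_numeral)
      finally show ?thesis .
    qed
    ultimately show "S \<in> (\<Union>k\<in>{1..n}. ?A k)" using k(1) by blast
  qed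
  then have "prob {S. energy S n > real n * y} \<le> prob (\<Union>k\<in>{1..n}. ?A k)"
    by (intro finite_measure_mono sets.finite_UN sets_mart) auto
  also have "\<dots> \<le> (\<Sum>k\<in>{1..n}. prob (?A k))"
    by (intro measure_UNION_le sets_mart) auto
  also have "\<dots> \<le> (\<Sum>k\<in>{1..n}. exp (- (a\<^sup>2 / (2 * v))))"
    by (intro sum_mono mart_tail av)
  also have "a\<^sup>2 / (2 * v) = y powr (2/3) * real n powr (1/3) / (512 * qv_const)"
    unfolding u2 m_def[symmetric] a_def v_def unfolding m3 u3 using mu
    by (simp add: field_simps eval_nat_numeral)
  finally show ?thesis by simp
qed

text \<open>The energy bound is part of the event, so no crossing time is needed. The threshold 1602
  n is 800 * 2n from the drift plus 2n for the martingale.\<close>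

lemma excess_upper_tail:
  assumes n: "n \<ge> 1" and L: "L \<ge> 1" and y: "y \<ge> 1"
  shows "measure (srw 0) {S :: nat \<Rightarrow> int ^ 3. (\<Sum>x\<in>S ` {..n}. (excess L S n x)\<^sup>2) > 1602 * real n \<and> energy S n \<le> real n * y}
    \<le> exp (- (real n powr (1/3) * real L powr (1/3) / (4 * qv_const * y\<^sup>2)))"
proof -
  interpret prob_space "srw (0 :: int ^ 3)" by (rule prob_space_srw)
  define m w where "m = real n powr (1/3)" and "w = real L powr (1/3)"
  have mw: "m > 0" "w > 0" using n L by (auto simp: m_def w_def)
  have m3: "real n = m ^ 3" and w3: "real L = w ^ 3" using n L by (simp_all add: m_def w_def powr_power)
  define v where "v = 2 * qv_const * (m ^ 5 * y\<^sup>2 / w)"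
  have v: "v > 0" using mw y by (auto simp: v_def)
  let ?A = "{S. real n \<le> mart L S n \<and> quadvar L S n \<le> v}"
  have "{S :: nat \<Rightarrow> int ^ 3. (\<Sum>x\<in>S ` {..n}. (excess L S n x)\<^sup>2) > 1602 * real n \<and> energy S n \<le> real n * y} \<subseteq> ?A"
  proof
    fix S :: "nat \<Rightarrow> int ^ 3"
    assume "S \<in> {S. (\<Sum>x\<in>S ` {..n}. (excess L S n x)\<^sup>2) > 1602 * real n \<and> energy S n \<le> real n * y}"
    then have x: "(\<Sum>x\<in>S ` {..n}. (excess L S n x)\<^sup>2) > 1602 * real n" and e: "energy S n \<le> real n * y" by auto
    have "(\<Sum>x\<in>S ` {..n}. excess L S n x) \<le> (\<Sum>x\<in>S ` {..n}. real (local_time S n x))"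
      by (intro sum_mono excess_le)
    also have "\<dots> \<le> 2 * real n" using sum_local_time[of "S ` {..n}" S n] n by simp
    finally have "real n \<le> mart L S n" using sum_excess_sq_le[of L S n] x by linarith
    moreover have "quadvar L S n \<le> v"
    proof -
      \<comment> \<open>A site with positive excess has local time above \<open>L\<close>. This
        converts the energy bound into an l1 bound that improves with \<open>L\<close>.\<close>
      have "excess L S n x \<le> (real (local_time S n x))\<^sup>2 / real L" for x
      proof (cases "local_time S n x \<le> L")
        case False
        then have "real L * real (local_time S n x) \<le> real (local_time S n x) * real (local_time S n x)"
          by (intro mult_right_mono) auto
        then have "real (local_time S n x) \<le> (real (local_time S n x))\<^sup>2 / real L"
          using L by (simp add: pos_le_divide_eq power2_eq_square mult.commute)
        then show ?thesis using excess_le[of L S n x] by linarith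
      qed (simp add: excess_def)
      then have "(\<Sum>x\<in>S ` {..n}. excess L S n x) \<le> (\<Sum>x\<in>S ` {..n}. (real (local_time S n x))\<^sup>2 / real L)"
        by (rule sum_mono)
      also have "\<dots> = energy S n / real L" by (simp add: energy_def sum_divide_distrib)
      also have "\<dots> \<le> real n * y / real L" using e by (intro divide_right_mono) auto
      finally have c: "(\<Sum>x\<in>S ` {..n}. excess L S n x) \<le> real n * y / real L" .
      have "(\<Sum>x\<in>S ` {..n}. (excess L S n x)\<^sup>2) \<le> energy S n"
        unfolding energy_def by (intro sum_mono power_mono excess_le) simp
      \<comment> \<open>With radius \<open>m / w\<^sup>2\<close> both terms are of order
        \<open>m\<^sup>2 / w\<close>, apart from powers of \<open>y\<close>; this is the gain of a
        factor \<open>L powr (1/3)\<close>.\<close>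
      then have "quadvar L S n \<le> qv_const * (real n * y * (sqrt (m / w\<^sup>2) * sqrt (real n * y) + real n * y / real L / (m / w\<^sup>2)))"
        using mw e c by (intro quadvar_le_bounds) auto
      also have "sqrt (m / w\<^sup>2) * sqrt (real n * y) = m\<^sup>2 / w * sqrt y"
      proof -
        have "m / w\<^sup>2 * (real n * y) = (m\<^sup>2 / w)\<^sup>2 * y"
          unfolding m3 using mw by (simp add: field_simps eval_nat_numeral)
        then have "sqrt (m / w\<^sup>2 * (real n * y)) = sqrt ((m\<^sup>2 / w)\<^sup>2) * sqrt y"
          by (simp only: real_sqrt_mult)
        also have "sqrt ((m\<^sup>2 / w)\<^sup>2) = m\<^sup>2 / w" using mw by (simp only: real_sqrt_abs) simp
        finally show ?thesis by (simp only: real_sqrt_mult)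
      qed
      also have "real n * y / real L / (m / w\<^sup>2) = m\<^sup>2 / w * y"
        unfolding m3 w3 using mw by (simp add: field_simps eval_nat_numeral)
      also have "qv_const * (real n * y * (m\<^sup>2 / w * sqrt y + m\<^sup>2 / w * y))
          \<le> qv_const * (real n * y * (m\<^sup>2 / w * y + m\<^sup>2 / w * y))"
      proof -
        have "sqrt y \<le> sqrt (y\<^sup>2)" using y by (intro real_sqrt_le_mono) (simp add: power2_eq_square)
        then have "sqrt y \<le> y" using y by simp
        then show ?thesis using mw y by (intro mult_left_mono add_mono) auto
      qed
      also have "\<dots> = v" unfolding m3 v_def by (simp add: eval_nat_numeral)
      finally show ?thesis .
    qed
    ultimately show "S \<in> ?A" by blast
  qed
  then have "prob {S :: nat \<Rightarrow> int ^ 3. (\<Sum>x\<in>S ` {..n}. (excess L S n x)\<^sup>2) > 1602 * real n \<and> energy S n \<le> real n * y} \<le> prob ?A"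
    by (intro finite_measure_mono sets_mart)
  also have "\<dots> \<le> exp (- ((real n)\<^sup>2 / (2 * v)))"
    using n by (intro mart_tail v) auto
  also have "(real n)\<^sup>2 / (2 * v) = m * w / (4 * qv_const * y\<^sup>2)"
    unfolding v_def m3 using mw y by (simp add: field_simps eval_nat_numeral)
  finally show ?thesis by (simp add: m_def w_def)
qed

text \<open>The powers 1 and 2/3 of the logarithm both beat 1/2. Each term is brought below half of
  the target, which costs \<open>ln 2\<close>, and the factor \<open>n\<close> costs
  \<open>ln n\<close>.\<close>

lemma eventually_final_bound:
  fixes c b d :: real
  assumes "c > 0" "b > 0" "d > 0"
  shows "\<forall>\<^sub>F n :: nat in sequentially. exp (- (b * real n powr (1/3) * ln (real n))) +
    real n * exp (- (c * real n powr (1/3) * ln (real n) powr (2/3)))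
    \<le> exp (- d * real n powr (1/3) * ln (real n) powr (1/2))"
proof -
  have 1: "\<forall>\<^sub>F n :: nat in sequentially. d * real n powr (1/3) * ln (real n) powr (1/2) + ln 2
      \<le> b * real n powr (1/3) * ln (real n)"
    using assms by real_asymp
  have 2: "\<forall>\<^sub>F n :: nat in sequentially. d * real n powr (1/3) * ln (real n) powr (1/2) + ln 2 + ln (real n)
      \<le> c * real n powr (1/3) * ln (real n) powr (2/3)"
    using assms by real_asymp
  show ?thesis
    using 1 2 eventually_gt_at_top[of 0]
  proof eventually_elim
    case (elim n)
    let ?D = "d * real n powr (1/3) * ln (real n) powr (1/2)"
    have "exp (- (b * real n powr (1/3) * ln (real n))) \<le> exp (- ?D - ln 2)" using elim(1) by simp
    also have "\<dots> = exp (- ?D) / 2" by (simp add: exp_diff)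
    finally have a: "exp (- (b * real n powr (1/3) * ln (real n))) \<le> exp (- ?D) / 2" .
    have "real n * exp (- (c * real n powr (1/3) * ln (real n) powr (2/3)))
        = exp (ln (real n) - c * real n powr (1/3) * ln (real n) powr (2/3))"
      using elim(3) by (simp add: exp_diff exp_minus field_simps)
    also have "\<dots> \<le> exp (- ?D - ln 2)" using elim(2) by simp
    also have "\<dots> = exp (- ?D) / 2" by (simp add: exp_diff)
    finally show ?case using a by simp
  qed
qed

text \<open>Where the local time exceeds twice the level, the excess is at least half of it.\<close>

lemma high_sites_le:
  assumes "2 * real L \<le> T"
  shows "(\<Sum>\<^sub>\<infinity>x\<in>{x. real (local_time S n x) > T}. (real (local_time S n x))\<^sup>2)
    \<le> 4 * (\<Sum>x\<in>S ` {..n}. (excess L S n x)\<^sup>2)"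
proof -
  have "(\<Sum>x\<in>S ` {..n} \<inter> {x. real (local_time S n x) > T}. (real (local_time S n x))\<^sup>2)
      \<le> (\<Sum>x\<in>S ` {..n} \<inter> {x. real (local_time S n x) > T}. 4 * (excess L S n x)\<^sup>2)"
  proof (rule sum_mono)
    fix x assume "x \<in> S ` {..n} \<inter> {x. real (local_time S n x) > T}"
    then have "2 * L < local_time S n x" using assms by simp
    then have "real (local_time S n x) \<le> 2 * excess L S n x" by (simp add: excess_def of_nat_diff)
    then have "(real (local_time S n x))\<^sup>2 \<le> (2 * excess L S n x)\<^sup>2" by (intro power_mono) auto
    then show "(real (local_time S n x))\<^sup>2 \<le> 4 * (excess L S n x)\<^sup>2" by (simp add: power_mult_distrib)
  qed
  also have "\<dots> \<le> (\<Sum>x\<in>S ` {..n}. 4 * (excess L S n x)\<^sup>2)" by (intro sum_mono2) auto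
  finally show ?thesis by (simp add: infsum_local_time_sq sum_distrib_left)
qed

text \<open>The event is split according to whether the energy exceeds n ln n. Below that level the
  excess bound applies, above it \<open>energy_upper_tail\<close> with \<open>y\<close> replaced by
  the logarithm, which is why 3200 bounds the logarithm.\<close>

lemma high_sites_tail:
  assumes n: "ln (real n) \<ge> 3200" and y: "y \<ge> 6408"
  shows "measure (srw 0) {S :: nat \<Rightarrow> int ^ 3.
      (\<Sum>\<^sub>\<infinity>x\<in>{x. real (local_time S n x) > ln (real n) powr 9}. (real (local_time S n x))\<^sup>2) > real n * y}
    \<le> exp (- (1 / (8 * qv_const) * real n powr (1/3) * ln (real n))) +
      real n * exp (- (1 / (512 * qv_const) * real n powr (1/3) * ln (real n) powr (2/3)))"
proof -
  interpret prob_space "srw (0 :: int ^ 3)" by (rule prob_space_srw)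
  define l where "l = ln (real n)"
  have l: "l \<ge> 3200" using n by (simp add: l_def)
  have n1: "n \<ge> 1" using n by (cases n) auto
  \<comment> \<open>The ninth power makes \<open>L powr (1/3)\<close> at least
    \<open>l ^ 3 / 2\<close>. Division by \<open>l\<^sup>2\<close>, from the energy level n l, still
    leaves a factor \<open>l\<close>.\<close>
  define L where "L = nat \<lfloor>l ^ 9 / 2\<rfloor>"
  have l9: "l ^ 9 \<ge> 8" using power_mono[of 2 l 9] l by simp
  have "0 \<le> l ^ 9 / 2" using l9 by linarith
  then have L: "real L = real_of_int \<lfloor>l ^ 9 / 2\<rfloor>" by (simp add: L_def)
  have L2: "2 * real L \<le> l ^ 9" unfolding L by linarith
  have L8: "(l ^ 3 / 2) ^ 3 \<le> real L"
  proof -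
    have "l ^ 9 / 2 \<le> real L + 1" unfolding L by linarith
    then show ?thesis using l9 by (simp add: power_divide)
  qed
  have L1: "L \<ge> 1"
  proof -
    have "1 \<le> l ^ 9 / 8" using l9 by simp
    also have "\<dots> \<le> real L" using L8 by (simp add: power_divide)
    finally show ?thesis by simp
  qed
  let ?X = "\<lambda>S. \<Sum>x\<in>S ` {..n}. (excess L S n x)\<^sup>2"
  let ?H = "{S :: nat \<Rightarrow> int ^ 3. (\<Sum>\<^sub>\<infinity>x\<in>{x. real (local_time S n x) > ln (real n) powr 9}. (real (local_time S n x))\<^sup>2) > real n * y}"
  let ?B = "{S :: nat \<Rightarrow> int ^ 3. ?X S > 1602 * real n \<and> energy S n \<le> real n * l}"
  let ?C = "{S :: nat \<Rightarrow> int ^ 3. energy S n > real n * l}"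
  have B: "?B \<in> events"
  proof (rule sets_adapted_srw[of n], rule adaptedI)
    fix S S' :: "nat \<Rightarrow> int ^ 3" assume e: "\<And>k. k \<le> n \<Longrightarrow> S k = S' k"
    have "energy S n = energy S' n" "excess L S n = excess L S' n" "S ` {..n} = S' ` {..n}"
      by (rule energy_cong excess_cong image_cong_prefix, rule e, assumption)+
    then show "(?X S > 1602 * real n \<and> energy S n \<le> real n * l) = (?X S' > 1602 * real n \<and> energy S' n \<le> real n * l)"
      by (simp only:)
  qed
  have "?H \<subseteq> ?B \<union> ?C"
  proof
    fix S assume "S \<in> ?H"
    moreover have "2 * real L \<le> ln (real n) powr 9" using L2 l by (simp add: l_def powr_numeral)
    ultimately have "real n * y < 4 * ?X S" using high_sites_le[of L "ln (real n) powr 9" S n] by simp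
    \<comment> \<open>6408 is 4 * 1602, the 4 coming from \<open>high_sites_le\<close>.\<close>
    moreover have "real n * 6408 \<le> real n * y" using y by (intro mult_left_mono) auto
    ultimately have "1602 * real n < ?X S" by linarith
    then show "S \<in> ?B \<union> ?C" by auto
  qed
  then have "prob ?H \<le> prob (?B \<union> ?C)" using B by (intro finite_measure_mono) auto
  also have "\<dots> \<le> prob ?B + prob ?C" using B by (intro measure_Un_le) auto
  also have "prob ?B \<le> exp (- (real n powr (1/3) * real L powr (1/3) / (4 * qv_const * l\<^sup>2)))"
    using l by (intro excess_upper_tail n1 L1) simp
  also have "\<dots> \<le> exp (- (1 / (8 * qv_const) * real n powr (1/3) * l))"
  proof -
    have "l ^ 3 / 2 = ((l ^ 3 / 2) ^ 3) powr (1/3)"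
      using l by (simp add: powr_realpow[symmetric] powr_powr del: powr_numeral)
    also have "\<dots> \<le> real L powr (1/3)" using L8 l by (intro powr_mono2) auto
    finally have "l ^ 3 / 2 \<le> real L powr (1/3)" .
    then have "real n powr (1/3) * (l ^ 3 / 2) / (4 * qv_const * l\<^sup>2)
        \<le> real n powr (1/3) * real L powr (1/3) / (4 * qv_const * l\<^sup>2)"
      by (intro divide_right_mono mult_left_mono) auto
    moreover have "real n powr (1/3) * (l ^ 3 / 2) / (4 * qv_const * l\<^sup>2) = 1 / (8 * qv_const) * real n powr (1/3) * l"
      using l by (simp add: field_simps eval_nat_numeral)
    ultimately show ?thesis by (simp only: exp_le_cancel_iff neg_le_iff_le)
  qed
  also have "prob ?C \<le> real n * exp (- (l powr (2/3) * real n powr (1/3) / (512 * qv_const)))"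
    using l by (intro energy_upper_tail n1)
  finally show ?thesis by (simp add: l_def mult.commute)
qed

section \<open>Assembly of the lower bound and the two upper bounds\<close>

theorem proposition1p1:
  shows "\<exists>c_low c_up :: real. c_low > 0 \<and> c_up > 0 \<and>
    (\<forall>\<^sub>F y :: real in at_top. \<forall>\<^sub>F n :: nat in sequentially.
       exp (- c_low * y powr (2/3) * real n powr (1/3))
         \<le> \<P>(S in srw (0 :: int ^ 3). (\<Sum>\<^sub>\<infinity>x. (real (local_time S n x))\<^sup>2) > real n * y) \<and>
       \<P>(S in srw (0 :: int ^ 3). (\<Sum>\<^sub>\<infinity>x. (real (local_time S n x))\<^sup>2) > real n * y)
         \<le> exp (- c_up * y powr (1/3) * real n powr (1/3))) \<and>
    (\<exists>chi :: real. chi > 0 \<and> (\<exists>\<epsilon> :: real. \<epsilon> > 0 \<and>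
       (\<forall>\<^sub>F y :: real in at_top. \<forall>\<^sub>F n :: nat in sequentially.
          \<P>(S in srw (0 :: int ^ 3).
              (\<Sum>\<^sub>\<infinity>x\<in>{x. real (local_time S n x) > ln (real n) powr chi}.
                 (real (local_time S n x))\<^sup>2) > real n * y)
            \<le> exp (- c_up * real n powr (1/3) * ln (real n) powr \<epsilon>))))"
proof -
  \<comment> \<open>Half of the rate in \<open>energy_upper_tail\<close>; the other half absorbs the
    union-bound factor \<open>n\<close>.\<close>
  define c where "c = 1 / (1024 * qv_const)"
  have c: "c > 0" by (simp add: c_def)
  have lower: "\<forall>\<^sub>F y :: real in at_top. \<forall>\<^sub>F n :: nat in sequentially.
       exp (- 64 * y powr (2/3) * real n powr (1/3)) \<le> measure (srw 0) {S :: nat \<Rightarrow> int ^ 3. energy S n > real n * y}"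
    using eventually_gt_at_top[of 0]
  proof eventually_elim
    case (elim y)
    have "\<forall>\<^sub>F n :: nat in sequentially. (real n / y) powr (1/3) \<ge> 4" using elim by real_asymp
    then show ?case by eventually_elim (rule energy_lower_tail[OF elim])
  qed
  have upper: "\<forall>\<^sub>F y :: real in at_top. \<forall>\<^sub>F n :: nat in sequentially.
       measure (srw 0) {S :: nat \<Rightarrow> int ^ 3. energy S n > real n * y} \<le> exp (- c * y powr (1/3) * real n powr (1/3))"
    using eventually_ge_at_top[of 3200]
  proof eventually_elim
    case (elim y)
    have "\<forall>\<^sub>F n :: nat in sequentially. ln (real n) \<le> c * real n powr (1/3)" using c by real_asymp
    then show ?case using eventually_ge_at_top[of 1]
    proof eventually_elim
      case (elim n)
      let ?m = "real n powr (1/3)"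
      have y1: "1 \<le> y powr (1/3)" using \<open>3200 \<le> y\<close> by (intro ge_one_powr_ge_zero) auto
      \<comment> \<open>The tail bound has the stronger power 2/3 of \<open>y\<close>, which is
        weakened here to the claimed 1/3.\<close>
      have y2: "y powr (1/3) \<le> y powr (2/3)" using \<open>3200 \<le> y\<close> by (intro powr_mono) auto
      have "measure (srw 0) {S :: nat \<Rightarrow> int ^ 3. energy S n > real n * y}
          \<le> real n * exp (- (y powr (2/3) * ?m / (512 * qv_const)))"
        by (rule energy_upper_tail) fact+
      also have "\<dots> = exp (ln (real n) - 2 * (c * (y powr (2/3) * ?m)))"
      proof -
        have "y powr (2/3) * ?m / (512 * qv_const) = 2 * (c * (y powr (2/3) * ?m))" by (simp add: c_def)
        moreover have "real n * exp (- z) = exp (ln (real n) - z)" for z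
          using elim(2) by (simp add: exp_diff exp_minus divide_inverse)
        ultimately show ?thesis by (simp only:)
      qed
      also have "\<dots> \<le> exp (- c * y powr (1/3) * ?m)"
      proof -
        have "c * ?m * 1 \<le> c * ?m * y powr (1/3)" using y1 c by (intro mult_left_mono) auto
        moreover have "c * ?m * y powr (1/3) \<le> c * ?m * y powr (2/3)" using y2 c by (intro mult_left_mono) auto
        ultimately show ?thesis using elim(1) by (simp add: algebra_simps)
      qed
      finally show ?case .
    qed
  qed
  have high: "\<forall>\<^sub>F y :: real in at_top. \<forall>\<^sub>F n :: nat in sequentially.
      measure (srw 0) {S :: nat \<Rightarrow> int ^ 3.
        (\<Sum>\<^sub>\<infinity>x\<in>{x. real (local_time S n x) > ln (real n) powr 9}. (real (local_time S n x))\<^sup>2) > real n * y}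
      \<le> exp (- c * real n powr (1/3) * ln (real n) powr (1/2))"
    using eventually_ge_at_top[of 6408]
  proof eventually_elim
    case (elim y)
    have "\<forall>\<^sub>F n :: nat in sequentially. ln (real n) \<ge> 3200" by real_asymp
    \<comment> \<open>The target constant in \<open>eventually_final_bound\<close> is arbitrary, so
      the same \<open>c\<close> serves here.\<close>
    moreover have "\<forall>\<^sub>F n :: nat in sequentially. exp (- (1 / (8 * qv_const) * real n powr (1/3) * ln (real n))) +
        real n * exp (- (1 / (512 * qv_const) * real n powr (1/3) * ln (real n) powr (2/3)))
        \<le> exp (- c * real n powr (1/3) * ln (real n) powr (1/2))"
      by (rule eventually_final_bound) (auto simp: c)
    ultimately show ?case
      by eventually_elim (rule order_trans[OF high_sites_tail[OF _ elim]])
  qed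
  have "\<forall>\<^sub>F y :: real in at_top. \<forall>\<^sub>F n :: nat in sequentially.
       exp (- 64 * y powr (2/3) * real n powr (1/3)) \<le> measure (srw 0) {S :: nat \<Rightarrow> int ^ 3. energy S n > real n * y} \<and>
       measure (srw 0) {S :: nat \<Rightarrow> int ^ 3. energy S n > real n * y} \<le> exp (- c * y powr (1/3) * real n powr (1/3))"
    using lower upper by eventually_elim (rule eventually_conj)
  then show ?thesis
    using c high
    by (intro exI[of _ "64 :: real"] exI[of _ c] conjI exI[of _ "9 :: real"] exI[of _ "1/2 :: real"])
      (simp_all add: infsum_eq_energy)
qed

end
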